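(* Let $D$ be a prime. An eta quotient $E(z)$ of level $D$ is half the difference of two theta functions of level $D$ if and only if $D\equiv 23\pmod{24}$ and $E(z)=\eta(z)\eta(Dz)$. Moreover, for a prime $D\equiv 23\pmod{24}$, we have $$\eta(z)\eta(Dz)=\frac12\left(\sum_{a,b\in\mathbb{Z}}q^{Q_{s_0}(a,b)}-\sum_{a,b\in\mathbb{Z}}q^{Q_{r_0}(a,b)}\right),$$ where $(Q_{s_0}(x,y),Q_{r_0}(x,y))$ is the Schoeneberg pair of discriminant $-D$, and this representation of $\eta(z)\eta(Dz)$ as half the difference of two theta functions of level $D$ is unique up to proper equivalence and conjugation of the forms $Q_{s_0}(x,y)$ and $Q_{r_0}(x,y)$.
   Context: Here $q=e^{2\pi iz}$ with $z$ in the upper half-plane, $\eta(z)=q^{1/24}\prod_{n\ge1}(1-q^n)$, and an eta quotient of level $N$ is a function $\prod_{\delta\mid N}\eta(\delta z)^{r_\delta}$ with integer exponents $r_\delta$. Binary quadratic forms $Q(x,y)=ax^2+bxy+cy^2$ are integral, primitive and positive definite, with discriminant $b^2-4ac$. The theta function of $Q$ is $\Theta_Q(z)=\sum_{a,b\in\mathbb{Z}}q^{Q(a,b)}$; it is a theta function of level $D$ if $Q$ has discriminant $-D$. Thus "half the difference of two theta functions of level $D$" means a function $\frac12(\Theta_{Q_s}-\Theta_{Q_r})$ with $Q_s,Q_r$ distinct reduced forms of discriminant $-D$, where $ax^2+bxy+cy^2$ is reduced if $|b|\le a\le c$, and $b\ge0$ whenever $|b|=a$ or $a=c$. (Every primitive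 positive definite form is properly equivalent to a unique reduced form, and properly equivalent forms have the same theta function.) Two forms $Q_1,Q_2$ are properly equivalent if $Q_1(x,y)=Q_2(px+qy,rx+sy)$ for integers $p,q,r,s$ with $ps-qr=1$. The conjugate of $ax^2+bxy+cy^2$ is $ax^2-bxy+cy^2$. Uniqueness up to proper equivalence and conjugation means: if $\eta(z)\eta(Dz)=\frac12(\Theta_{Q_s}-\Theta_{Q_r})$ with $Q_s,Q_r$ of discriminant $-D$, then $Q_s$ is properly equivalent to $Q_{s_0}$ or to its conjugate, and $Q_r$ is properly equivalent to $Q_{r_0}$ or to its conjugate. The Schoeneberg pair $(Q_{s_0},Q_{r_0})$ of discriminant $-D$, for $D\equiv 23\pmod{24}$, is defined as follows. If $(D+1)/24\ge 6$, then $$Q_{s_0}(x,y)=6x^2+xy+\tfrac{D+1}{24}y^2,\qquad Q_{r_0}(x,y)=6x^2+5xy+\tfrac{D+25}{24}y^2.$$ If $(D+1)/24<6$, then $(Q_{s_0},Q_{r_0})$ is: for $D=23$: $(x^2+xy+6y^2,\ 2x^2+xy+3y^2)$; for $D=47$: $(2x^2+xy+6y^2,\ 3x^2+xy+4y^2)$; for $D=71$: $(3x^2+xy+6y^2,\ 4x^2+3xy+5y^2)$; for $D=95$: $(4x^2+xy+6y^2,\ 5x^2+5xy+6y^2)$; for $D=119$: $(5x^2+xy+6y^2,\ 6x^2+5xy+6y^2)$. *)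

theory Defs
  imports "HOL-Analysis.Analysis" "HOL-Computational_Algebra.Computational_Algebra"
begin

definition upper_half_plane :: "complex set" where
  "upper_half_plane = {z. Im z > 0}"

definition nome :: "complex \<Rightarrow> complex" where
  "nome z = exp (2 * of_real pi * \<i> * z)"

text \<open>The factor \<open>q\<^sup>1\<^sup>/\<^sup>2\<^sup>4\<close> means \<open>exp (2\<pi>iz/24)\<close>, not a branch of a root of \<open>q\<close>.\<close>

definition dedekind_eta :: "complex \<Rightarrow> complex" where
  "dedekind_eta z = exp (2 * of_real pi * \<i> * z / 24) * (\<Prod>n. 1 - nome z ^ Suc n)"

text \<open>Functions on the upper half-plane are modelled as total functions, and only their values
  on the upper half-plane matter.\<close>

definition is_eta_quotient :: "nat \<Rightarrow> (complex \<Rightarrow> complex) \<Rightarrow> bool" where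
  "is_eta_quotient N E \<longleftrightarrow>
     (\<exists>r :: nat \<Rightarrow> int. \<forall>z\<in>upper_half_plane.
        E z = (\<Prod>\<delta> | \<delta> dvd N. dedekind_eta (of_nat \<delta> * z) powi r \<delta>))"

datatype qform = QForm (qa: int) (qb: int) (qc: int)

definition qeval :: "qform \<Rightarrow> 'a \<Rightarrow> 'a \<Rightarrow> 'a :: comm_ring_1" where
  "qeval Q x y = of_int (qa Q) * x\<^sup>2 + of_int (qb Q) * x * y + of_int (qc Q) * y\<^sup>2"

definition discriminant :: "qform \<Rightarrow> int" where
  "discriminant Q = (qb Q)\<^sup>2 - 4 * qa Q * qc Q"

definition primitive_form :: "qform \<Rightarrow> bool" where
  "primitive_form Q \<longleftrightarrow> Gcd {qa Q, qb Q, qc Q} = 1"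

definition positive_definite :: "qform \<Rightarrow> bool" where
  "positive_definite Q \<longleftrightarrow> (\<forall>x y :: real. (x, y) \<noteq> (0, 0) \<longrightarrow> qeval Q x y > 0)"

definition forms_of_disc :: "int \<Rightarrow> qform set" where
  "forms_of_disc d = {Q. primitive_form Q \<and> positive_definite Q \<and> discriminant Q = d}"

definition reduced_form :: "qform \<Rightarrow> bool" where
  "reduced_form Q \<longleftrightarrow> \<bar>qb Q\<bar> \<le> qa Q \<and> qa Q \<le> qc Q \<and>
     (\<bar>qb Q\<bar> = qa Q \<or> qa Q = qc Q \<longrightarrow> qb Q \<ge> 0)"

definition properly_equivalent :: "qform \<Rightarrow> qform \<Rightarrow> bool" where
  "properly_equivalent Q1 Q2 \<longleftrightarrow>
     (\<exists>p q r s :: int. p * s - q * r = 1 \<and>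
        (\<forall>x y :: int. qeval Q1 x y = qeval Q2 (p * x + q * y) (r * x + s * y)))"

definition conjugate_form :: "qform \<Rightarrow> qform" where
  "conjugate_form Q = QForm (qa Q) (- qb Q) (qc Q)"

definition form_theta :: "qform \<Rightarrow> complex \<Rightarrow> complex" where
  "form_theta Q z = (\<Sum>\<^sub>\<infinity>(a, b)\<in>(UNIV :: (int \<times> int) set). nome z powi qeval Q a b)"

definition half_theta_diff :: "qform \<Rightarrow> qform \<Rightarrow> complex \<Rightarrow> complex" where
  "half_theta_diff Qs Qr z = (form_theta Qs z - form_theta Qr z) / 2"

definition is_half_theta_diff :: "nat \<Rightarrow> (complex \<Rightarrow> complex) \<Rightarrow> bool" where
  "is_half_theta_diff D E \<longleftrightarrow>
     (\<exists>Qs Qr. Qs \<in> forms_of_disc (- int D) \<and> reduced_form Qs \<and>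
              Qr \<in> forms_of_disc (- int D) \<and> reduced_form Qr \<and> Qs \<noteq> Qr \<and>
              (\<forall>z\<in>upper_half_plane. E z = half_theta_diff Qs Qr z))"

text \<open>Only meaningful for \<open>D mod 24 = 23\<close>, where both divisions by 24 are exact.\<close>

definition schoeneberg_pair :: "nat \<Rightarrow> qform \<times> qform" where
  "schoeneberg_pair D =
     (if (D + 1) div 24 \<ge> 6 then
        (QForm 6 1 (int ((D + 1) div 24)), QForm 6 5 (int ((D + 25) div 24)))
      else if D = 23 then (QForm 1 1 6, QForm 2 1 3)
      else if D = 47 then (QForm 2 1 6, QForm 3 1 4)
      else if D = 71 then (QForm 3 1 6, QForm 4 3 5)
      else if D = 95 then (QForm 4 1 6, QForm 5 5 6)
      else if D = 119 then (QForm 5 1 6, QForm 6 5 6)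
      else undefined)"

end

theory Submission
  imports Defs
begin

text \<open>
  Multiplying by 24 turns the two forms \<open>6x\<^sup>2 + xy + ky\<^sup>2\<close> and \<open>6x\<^sup>2 + 5xy + (k+1)y\<^sup>2\<close> with \<open>24k = D + 1\<close>
  into \<open>u\<^sup>2 + Dy\<^sup>2\<close> on the lattices \<open>u \<equiv> y\<close> and \<open>u \<equiv> 5y (mod 12)\<close>. By sign changes the vectors with
  \<open>gcd (y, 6) > 1\<close> cancel in the difference of the theta functions, and the remaining ones give, by the
  pentagonal number theorem, twice the product of the two eta series.

  Conversely, let \<open>\<eta>(z)\<^sup>a \<eta>(Dz)\<^sup>b\<close> be half the difference of the theta functions of two reduced forms.
  No modularity is needed: the first exponent \<open>N\<close> at which the representation numbers differ is the smaller
  of the leading coefficients or, if these agree, the smaller of the last coefficients. Comparing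
  the first two coefficients of the \<open>q\<close>-expansions gives \<open>24N = a + bD\<close> and, since a reduced form represents
  \<open>N + 1\<close> at most six times, \<open>\<bar>a\<bar> \<le> 3\<close>. The bound \<open>3a\<^sub>Q\<^sup>2 \<le> D\<close> for reduced forms and \<open>D \<equiv> 3 (mod 4)\<close> then
  leave only \<open>a = b = 1\<close>, and at the same time determine both forms up to conjugation.
\<close>

section \<open>The pentagonal number theorem\<close>

text \<open>Euler's function, the infinite q-Pochhammer symbol: eta without its factor
  q^(1/24).\<close>

definition euler_phi :: "complex \<Rightarrow> complex" where
  "euler_phi q = (\<Prod>n. 1 - q ^ Suc n)"

text \<open>Shanks' finite form of the pentagonal number theorem. On the left the summand for
  \<open>s = 0\<close> is the partial product, and the others carry a power of \<open>q\<close> of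
  exponent at least \<open>n\<close>, so that a limit can be taken. In the induction step everything
  telescopes except two terms, which are the two new pentagonal powers.\<close>

lemma shanks_identity:
  fixes q :: "'a :: comm_ring_1"
  shows "(\<Sum>s\<le>n. (-1) ^ s * (\<Prod>k\<in>{s<..n}. 1 - q ^ k) * q ^ (s * n + s * (s + 1) div 2)) =
         1 + (\<Sum>s=1..n. (-1) ^ s * (q ^ (s * (3 * s - 1) div 2) + q ^ (s * (3 * s + 1) div 2)))"
proof (induction n)
  case 0
  show ?case by simp
next
  case (Suc n)
  define T where "T = (\<lambda>s::nat. s * (s + 1) div 2)"
  define R where "R = (\<lambda>s. \<Prod>k\<in>{s<..n}. 1 - q ^ k)"
  define g where "g = (\<lambda>s. (-1) ^ s * R s * q ^ (Suc s * Suc n + T s))"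
  have T_Suc: "T (Suc s) = T s + Suc s" for s
    by (simp add: T_def)
  have R_Suc: "(\<Prod>k\<in>{s<..Suc n}. 1 - q ^ k) = R s * (1 - q ^ Suc n)" if "s \<le> n" for s
    using that by (simp add: R_def atLeastSucAtMost_greaterThanAtMost[symmetric])
  have R_pred: "R s = R (Suc s) * (1 - q ^ Suc s)" if "s < n" for s
    using that unfolding R_def
    by (simp add: atLeastSucAtMost_greaterThanAtMost[symmetric] prod.atLeast_Suc_atMost mult.commute)
  define h where "h = (\<lambda>s. (-1) ^ s * R s * (1 - q ^ s) * q ^ (s * n + T s))"
  \<comment> \<open>Writes q^s (1 - q^(n+1)) as 1 - (1 - q^s) - q^(s+n+1). The 1 reproduces the
    summand for \<open>n\<close>; the other two parts cancel between neighbouring \<open>s\<close>,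
    because \<open>R s\<close> is \<open>R (Suc s)\<close> times 1 - q^(s+1).\<close>
  have step: "(-1) ^ s * (R s * (1 - q ^ Suc n)) * q ^ (s * Suc n + T s)
      = (-1) ^ s * R s * q ^ (s * n + T s) - h s - g s" for s
    unfolding g_def h_def by (simp add: algebra_simps power_add)
  have h_Suc: "h (Suc s) = - g s" if "s < n" for s
    unfolding h_def g_def R_pred[OF that] by (simp add: T_Suc algebra_simps power_add)
  have h_sum: "(\<Sum>s\<le>n. h s) = - (\<Sum>s<n. g s)"
  proof -
    have "(\<Sum>s\<le>n. h s) = h 0 + (\<Sum>s<n. h (Suc s))"
      by (simp add: sum.atMost_shift)
    also have "h 0 = 0" by (simp add: h_def)
    also have "(\<Sum>s<n. h (Suc s)) = (\<Sum>s<n. - g s)"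
      by (rule sum.cong) (auto simp: h_Suc)
    finally show ?thesis by (simp add: sum_negf)
  qed
  have g_sum: "(\<Sum>s\<le>n. g s) = (\<Sum>s<n. g s) + g n"
    by (simp add: lessThan_Suc_atMost[symmetric])
  have "(\<Sum>s\<le>Suc n. (-1) ^ s * (\<Prod>k\<in>{s<..Suc n}. 1 - q ^ k) * q ^ (s * Suc n + s * (s + 1) div 2))
     = (\<Sum>s\<le>n. (-1) ^ s * (R s * (1 - q ^ Suc n)) * q ^ (s * Suc n + T s))
       + (-1) ^ Suc n * q ^ (Suc n * Suc n + T (Suc n))"
    unfolding sum.atMost_Suc using R_Suc by (simp add: T_def)
  also have "(\<Sum>s\<le>n. (-1) ^ s * (R s * (1 - q ^ Suc n)) * q ^ (s * Suc n + T s))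
     = (\<Sum>s\<le>n. (-1) ^ s * R s * q ^ (s * n + T s)) - g n"
    unfolding step sum_subtractf h_sum g_sum by simp
  also have "(\<Sum>s\<le>n. (-1) ^ s * R s * q ^ (s * n + T s)) =
     1 + (\<Sum>s=1..n. (-1) ^ s * (q ^ (s * (3 * s - 1) div 2) + q ^ (s * (3 * s + 1) div 2)))"
    using Suc.IH by (simp add: R_def T_def)
  also have "g n = (-1) ^ n * q ^ (Suc n * (3 * Suc n - 1) div 2)"
  proof -
    have "Suc n * Suc n + T n = Suc n * (3 * Suc n - 1) div 2"
    proof -
      have "even (n * (n + 1))" by simp
      then have "2 * T n = n * (n + 1)" unfolding T_def by simp
      then have "2 * (Suc n * Suc n + T n) = Suc n * (3 * Suc n - 1)" by (simp add: algebra_simps)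
      then show ?thesis by simp
    qed
    then show ?thesis by (simp add: g_def R_def)
  qed
  also have "Suc n * Suc n + T (Suc n) = Suc n * (3 * Suc n + 1) div 2"
  proof -
    have "even (Suc n * (Suc n + 1))" by simp
    then have "2 * T (Suc n) = Suc n * (Suc n + 1)" unfolding T_def by simp
    then have "2 * (Suc n * Suc n + T (Suc n)) = Suc n * (3 * Suc n + 1)" by (simp add: algebra_simps)
    then show ?thesis by simp
  qed
  finally show ?case by (simp add: algebra_simps)
qed

lemma euler_phi_convergent:
  assumes "norm q < 1"
  shows "convergent_prod (\<lambda>n. 1 - q ^ Suc n :: complex)"
proof -
  have "summable (\<lambda>n. norm (- (q ^ Suc n)))"
    using assms by (simp add: norm_power norm_mult summable_mult)
  then have "abs_convergent_prod (\<lambda>n. 1 - q ^ Suc n)"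
    by (intro summable_imp_abs_convergent_prod) (simp add: norm_minus_commute)
  then show ?thesis by (rule abs_convergent_prod_imp_convergent_prod)
qed

lemma euler_phi_LIMSEQ:
  assumes "norm q < 1"
  shows "(\<lambda>n. \<Prod>k\<in>{0<..n}. 1 - q ^ k) \<longlonglongrightarrow> euler_phi q"
proof -
  have "(\<lambda>n. \<Prod>i<n. 1 - q ^ Suc i) \<longlonglongrightarrow> euler_phi q"
    using convergent_prod_LIMSEQ[OF euler_phi_convergent[OF assms]]
    by (simp only: euler_phi_def LIMSEQ_lessThan_iff_atMost)
  moreover have "(\<Prod>i<n. 1 - q ^ Suc i) = (\<Prod>k\<in>{0<..n}. 1 - q ^ k)" for n
    by (rule prod.reindex_bij_witness[of _ "\<lambda>k. k - 1" Suc]) auto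
  ultimately show ?thesis by (simp only:)
qed

text \<open>The bound is uniform in \<open>s\<close> and \<open>n\<close>: |1 - q^k| <= 1 + |q|^k <=
  exp(|q|^k), and the exponents form a geometric series.\<close>

lemma norm_prod_one_minus_powers_le:
  fixes q :: complex
  assumes "norm q < 1"
  shows "norm (\<Prod>k\<in>{s<..n}. 1 - q ^ k) \<le> exp (1 / (1 - norm q))"
proof -
  have "norm (\<Prod>k\<in>{s<..n}. 1 - q ^ k) = (\<Prod>k\<in>{s<..n}. norm (1 - q ^ k))"
    by (simp add: prod_norm)
  also have "\<dots> \<le> (\<Prod>k\<in>{s<..n}. exp (norm q ^ k))"
  proof (rule prod_mono, intro conjI)
    fix k
    have "norm (1 - q ^ k) \<le> 1 + norm q ^ k"
      using norm_triangle_ineq4[of 1 "q ^ k"] by (simp add: norm_power)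
    also have "\<dots> \<le> exp (norm q ^ k)" by (rule exp_ge_add_one_self)
    finally show "norm (1 - q ^ k) \<le> exp (norm q ^ k)" .
  qed simp
  also have "\<dots> = exp (\<Sum>k\<in>{s<..n}. norm q ^ k)" by (simp add: exp_sum)
  also have "(\<Sum>k\<in>{s<..n}. norm q ^ k) \<le> (\<Sum>k. norm q ^ k)"
    using assms by (intro sum_le_suminf) auto
  also have "\<dots> = 1 / (1 - norm q)" using assms by (simp add: suminf_geometric)
  finally show ?thesis by simp
qed

text \<open>The left side of Shanks' identity differs from the partial product by at most M n |q|^n,
  so both have the same limit.\<close>

lemma pentagonal_LIMSEQ:
  fixes q :: complex
  assumes q: "norm q < 1"
  shows "(\<lambda>n. 1 + (\<Sum>s=1..n. (-1) ^ s * (q ^ (s * (3 * s - 1) div 2) + q ^ (s * (3 * s + 1) div 2))))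
           \<longlonglongrightarrow> euler_phi q"
proof -
  define M where "M = exp (1 / (1 - norm q))"
  define F where "F = (\<lambda>n. \<Sum>s\<le>n. (-1) ^ s * (\<Prod>k\<in>{s<..n}. 1 - q ^ k) * q ^ (s * n + s * (s + 1) div 2))"
  define P where "P = (\<lambda>n. \<Prod>k\<in>{0<..n}. 1 - q ^ k)"
  have "norm (F n - P n) \<le> M * (real n * norm q ^ n)" for n
  proof -
    have "F n - P n = (\<Sum>s\<in>{1..n}. (-1) ^ s * (\<Prod>k\<in>{s<..n}. 1 - q ^ k) * q ^ (s * n + s * (s + 1) div 2))"
      unfolding F_def P_def by (simp add: atMost_atLeast0 sum.atLeast_Suc_atMost)
    also have "norm \<dots> \<le> (\<Sum>s\<in>{1..n}. M * norm q ^ n)"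
    proof (rule sum_norm_le)
      fix s assume s: "s \<in> {1..n}"
      have "norm q ^ (s * n + s * (s + 1) div 2) \<le> norm q ^ n"
        using q s by (intro power_decreasing) (auto intro: trans_le_add1)
      then show "norm ((-1) ^ s * (\<Prod>k\<in>{s<..n}. 1 - q ^ k) * q ^ (s * n + s * (s + 1) div 2)) \<le> M * norm q ^ n"
        unfolding norm_mult norm_power M_def using norm_prod_one_minus_powers_le[OF q]
        by (auto intro!: mult_mono)
    qed
    finally show ?thesis by (simp add: mult_ac)
  qed
  moreover have "(\<lambda>n. M * (real n * norm q ^ n)) \<longlonglongrightarrow> M * 0"
    using q by (intro tendsto_mult tendsto_const powser_times_n_limit_0) auto
  ultimately have "(\<lambda>n. F n - P n) \<longlonglongrightarrow> 0"
    by (intro Lim_null_comparison[of "\<lambda>n. F n - P n"]) auto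
  from tendsto_add[OF this euler_phi_LIMSEQ[OF q]] have "F \<longlonglongrightarrow> euler_phi q"
    by (simp add: P_def)
  then show ?thesis unfolding F_def shanks_identity .
qed

lemma euler_phi_zero [simp]: "euler_phi 0 = 1"
  by (simp add: euler_phi_def)

text \<open>Supplies the second q-coefficient of an eta quotient in
  \<open>leading_coefficients\<close>. It follows from a quadratic error bound for |q| < 1/2, passed
  to the limit from the partial products.\<close>

lemma euler_phi_deriv_0: "(euler_phi has_field_derivative -1) (at 0)"
proof -
  have bound: "norm (euler_phi q - (1 - q)) \<le> 8 * norm q ^ 2" if q: "norm q < 1/2" for q
  proof -
    \<comment> \<open>The constant 8 is 2 times 4: |1 - q| <= 2, and the product of the factors with
      k >= 2 differs from 1 by at most exp(t) - 1 <= t + t^2 <= 4 |q|^2, where t = 2 |q|^2.\<close>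
    have fin: "norm ((\<Prod>k\<in>{0<..Suc n}. 1 - q ^ k) - (1 - q)) \<le> 8 * norm q ^ 2" for n
    proof -
      have e: "(\<Prod>k\<in>{0<..Suc n}. 1 - q ^ k) = (1 - q) * (\<Prod>k\<in>{2..Suc n}. 1 + - (q ^ k))"
      proof -
        have "{0<..Suc n} = insert 1 {2..Suc n}" by auto
        then show ?thesis by simp
      qed
      have "norm ((\<Prod>k\<in>{2..Suc n}. 1 + - (q ^ k)) - 1) \<le> (\<Prod>k\<in>{2..Suc n}. 1 + norm (- (q ^ k))) - 1"
        by (rule norm_prod_minus1_le_prod_minus1)
      also have "(\<Prod>k\<in>{2..Suc n}. 1 + norm (- (q ^ k))) \<le> (\<Prod>k\<in>{2..Suc n}. exp (norm q ^ k))"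
        by (intro prod_mono) (auto simp: norm_power)
      also have "\<dots> = exp (\<Sum>k\<in>{2..Suc n}. norm q ^ k)" by (simp only: exp_sum finite_atLeastAtMost)
      also have "(\<Sum>k\<in>{2..Suc n}. norm q ^ k) \<le> norm q ^ 2 * 2"
      proof -
        have "(\<Sum>k\<in>{2..Suc n}. norm q ^ k) = norm q ^ 2 * (\<Sum>k<n. norm q ^ k)"
          unfolding sum_distrib_left power_add[symmetric]
          by (rule sum.reindex_bij_witness[of _ "\<lambda>k. 2 + k" "\<lambda>k. k - 2"])
             (auto simp del: add_2_eq_Suc add_2_eq_Suc')
        also have "(\<Sum>k<n. norm q ^ k) \<le> (\<Sum>k. norm q ^ k)"
          using q by (intro sum_le_suminf) auto
        also have "\<dots> = 1 / (1 - norm q)" using q by (simp add: suminf_geometric)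
        also have "\<dots> \<le> 2" using q by (simp add: field_simps)
        finally show ?thesis by (simp add: mult_left_mono)
      qed
      also have "exp (norm q ^ 2 * 2) - 1 \<le> norm q ^ 2 * 2 + (norm q ^ 2 * 2) ^ 2"
      proof -
        have "norm q ^ 2 \<le> (1/2) ^ 2" using q by (intro power_mono) auto
        then show ?thesis using exp_bound[of "norm q ^ 2 * 2"] by (simp add: power2_eq_square)
      qed
      also have "\<dots> \<le> 4 * norm q ^ 2"
      proof -
        have "norm q ^ 2 \<le> (1/2) ^ 2" using q by (intro power_mono) auto
        then have "norm q ^ 2 * norm q ^ 2 \<le> 1/4 * norm q ^ 2"
          by (intro mult_right_mono) (auto simp: power_divide)
        moreover have "(norm q ^ 2 * 2) ^ 2 = 4 * (norm q ^ 2 * norm q ^ 2)"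
          by (simp add: power_mult_distrib power2_eq_square[of "norm q ^ 2"])
        moreover have "0 \<le> norm q ^ 2 * norm q ^ 2" by simp
        ultimately show ?thesis by linarith
      qed
      finally have *: "norm ((\<Prod>k\<in>{2..Suc n}. 1 + - (q ^ k)) - 1) \<le> 4 * norm q ^ 2" by simp
      have "norm (1 - q) \<le> 2" using norm_triangle_ineq4[of 1 q] q by simp
      with * have "norm (1 - q) * norm ((\<Prod>k\<in>{2..Suc n}. 1 + - (q ^ k)) - 1) \<le> 2 * (4 * norm q ^ 2)"
        by (intro mult_mono) auto
      then show ?thesis unfolding e norm_mult[symmetric] by (simp add: algebra_simps)
    qed
    have "(\<lambda>n. \<Prod>k\<in>{0<..Suc n}. 1 - q ^ k) \<longlonglongrightarrow> euler_phi q"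
      using euler_phi_LIMSEQ[of q] q by (intro LIMSEQ_Suc) auto
    then have "(\<lambda>n. norm ((\<Prod>k\<in>{0<..Suc n}. 1 - q ^ k) - (1 - q))) \<longlonglongrightarrow> norm (euler_phi q - (1 - q))"
      by (intro tendsto_intros)
    then show ?thesis using fin by (intro LIMSEQ_le_const2) auto
  qed
  have "((\<lambda>q. (euler_phi q - 1) / q - (-1)) \<longlongrightarrow> 0) (at 0)"
  proof (rule Lim_null_comparison)
    show "\<forall>\<^sub>F q in at 0. norm ((euler_phi q - 1) / q - (-1)) \<le> 8 * norm q"
      unfolding eventually_at
    proof (intro exI[of _ "1/2"] conjI ballI impI)
      fix q :: complex assume q: "q \<noteq> 0 \<and> dist q 0 < 1/2"
      then have "norm (euler_phi q - (1 - q)) \<le> 8 * norm q * norm q"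
        using bound[of q] by (simp add: power2_eq_square)
      moreover have "(euler_phi q - 1) / q - (-1) = (euler_phi q - (1 - q)) / q"
        using q by (simp add: field_simps)
      ultimately show "norm ((euler_phi q - 1) / q - (-1)) \<le> 8 * norm q"
        using q by (simp add: norm_divide field_simps)
    qed simp
    show "((\<lambda>q::complex. 8 * norm q) \<longlongrightarrow> 0) (at 0)"
      by (auto intro!: tendsto_eq_intros)
  qed
  then have "((\<lambda>q. (euler_phi q - 1) / q) \<longlongrightarrow> -1) (at 0)"
    by (simp add: Lim_null[of _ "-1"])
  then show ?thesis by (simp add: DERIV_def)
qed

section \<open>Summation over the integers and Gaussian sums\<close>

text \<open>Links unconditional summation over the integers with the partial sums of
  \<open>pentagonal_LIMSEQ\<close>, where s and -s enter together.\<close>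

lemma has_sum_int_symmetric_limit:
  fixes f :: "int \<Rightarrow> 'a :: real_normed_vector"
  assumes "(f has_sum S) UNIV"
  shows "(\<lambda>n. \<Sum>k\<in>{- int n..int n}. f k) \<longlonglongrightarrow> S"
proof -
  have "filterlim (\<lambda>n. {- int n..int n}) (finite_subsets_at_top UNIV) sequentially"
    unfolding filterlim_finite_subsets_at_top
  proof (intro allI impI)
    fix X :: "int set" assume "finite X \<and> X \<subseteq> UNIV"
    then have X: "finite (insert 0 ((\<lambda>x. nat \<bar>x\<bar>) ` X))" by simp
    show "\<forall>\<^sub>F n in sequentially. finite {- int n..int n} \<and> X \<subseteq> {- int n..int n} \<and> {- int n..int n} \<subseteq> UNIV"
      using eventually_ge_at_top[of "Max (insert 0 ((\<lambda>x. nat \<bar>x\<bar>) ` X))"]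
    proof eventually_elim
      case (elim n)
      have "x \<in> {- int n..int n}" if "x \<in> X" for x
      proof -
        have "nat \<bar>x\<bar> \<le> n" using elim X that by (meson Max_ge imageI insertCI order_trans)
        then show ?thesis by auto
      qed
      then show ?case by auto
    qed
  qed
  with assms show ?thesis unfolding has_sum_def by (rule filterlim_compose)
qed

text \<open>Since n^2 >= n, each half of the integers is dominated by a geometric series.\<close>

lemma gaussian_summable_int:
  fixes r :: real
  assumes "r > 0"
  shows "(\<lambda>u::int. exp (- r * (of_int u)\<^sup>2)) summable_on UNIV"
proof -
  have nat: "(\<lambda>n::nat. exp (- r * (real n)\<^sup>2)) summable_on UNIV"
  proof (rule norm_summable_imp_summable_on, rule summable_comparison_test')
    show "summable (\<lambda>n. exp (- r) ^ n)" using assms by (intro summable_geometric) auto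
    fix n :: nat
    have "real n \<le> real n * real n" by (metis le_square of_nat_le_iff of_nat_mult)
    then have "- r * (real n)\<^sup>2 \<le> real n * - r"
      using assms mult_left_mono[of "real n" "real n * real n" r] by (simp add: power2_eq_square mult.commute)
    then show "norm (norm (exp (- r * (real n)\<^sup>2))) \<le> exp (- r) ^ n"
      by (simp flip: exp_of_nat_mult)
  qed
  have "(\<lambda>u::int. exp (- r * (of_int u)\<^sup>2)) summable_on range int"
    using nat by (subst summable_on_reindex) (auto simp: o_def)
  moreover have "(\<lambda>u::int. exp (- r * (of_int u)\<^sup>2)) summable_on range (\<lambda>n. - int n)"
    using nat by (subst summable_on_reindex) (auto simp: o_def inj_on_def)
  ultimately have "(\<lambda>u::int. exp (- r * (of_int u)\<^sup>2)) summable_on (range int \<union> range (\<lambda>n. - int n))"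
    by (rule summable_on_union)
  moreover have "range int \<union> range (\<lambda>n. - int n) = UNIV"
  proof -
    have "x \<in> range int \<union> range (\<lambda>n. - int n)" for x
      by (cases x rule: int_cases2) auto
    then show ?thesis by auto
  qed
  ultimately show ?thesis by simp
qed

lemma summable_on_Times_mult:
  fixes f :: "'a \<Rightarrow> real" and g :: "'b \<Rightarrow> real"
  assumes "f summable_on A" "g summable_on B" "\<And>x. f x \<ge> 0" "\<And>y. g y \<ge> 0"
  shows "(\<lambda>(x, y). f x * g y) summable_on A \<times> B"
proof (rule summable_on_SigmaI)
  show "((\<lambda>y. case (x, y) of (x, y) \<Rightarrow> f x * g y) has_sum f x * infsum g B) B" for x
    using has_sum_cmult_right[OF has_sum_infsum[OF assms(2)], of "f x"] by simp
  show "(\<lambda>x. f x * infsum g B) summable_on A"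
    by (rule summable_on_cmult_left) fact
qed (use assms in auto)

lemma gaussian_summable_int2:
  fixes r s :: real
  assumes "r > 0" "s > 0"
  shows "(\<lambda>(u::int, y::int). exp (- r * (of_int u)\<^sup>2 - s * (of_int y)\<^sup>2)) summable_on UNIV"
  using summable_on_Times_mult[OF gaussian_summable_int[OF assms(1)] gaussian_summable_int[OF assms(2)]]
  by (simp add: exp_diff exp_minus divide_inverse case_prod_unfold)

section \<open>Eta as a series with quadratic exponents\<close>

text \<open>This is q^(m/24) defined through \<open>z\<close>, so that no branch is chosen and
  fractional powers of q become integer arguments \<open>m\<close>.\<close>

definition eta_exp :: "complex \<Rightarrow> int \<Rightarrow> complex" where
  "eta_exp z m = exp (2 * of_real pi * \<i> * z * of_int m / 24)"

lemma eta_exp_add: "eta_exp z (m + n) = eta_exp z m * eta_exp z n"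
  by (simp add: eta_exp_def exp_add[symmetric] algebra_simps add_divide_distrib)

lemma nome_powi: "nome z powi m = eta_exp z (24 * m)"
  by (simp add: nome_def eta_exp_def exp_power_int algebra_simps)

lemma norm_eta_exp: "norm (eta_exp z m) = exp (- (pi * Im z / 12) * of_int m)"
  by (simp add: eta_exp_def)

lemma norm_nome_less_1: "Im z > 0 \<Longrightarrow> norm (nome z) < 1"
  by (simp add: nome_def)

lemma nome_of_nat_mult: "nome (of_nat D * z) = nome z ^ D"
  by (simp add: nome_def exp_of_nat_mult[symmetric] algebra_simps)

lemma dedekind_eta_altdef:
  "dedekind_eta z = exp (2 * of_real pi * \<i> * z / 24) * euler_phi (nome z)"
  by (simp add: dedekind_eta_def euler_phi_def)

text \<open>The identity 24 s(3s + 1)/2 + 1 = (6s + 1)^2, for s of either sign, completes the square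
  in the pentagonal exponents; the factor q^(1/24) provides the 1. Absolute convergence is inherited
  from the Gaussian sum by restriction to u = 6n + 1.\<close>

lemma eta_series:
  assumes z: "Im z > 0"
  shows "((\<lambda>n. (if even n then 1 else -1) * eta_exp z ((6 * n + 1)\<^sup>2)) has_sum dedekind_eta z) UNIV"
    and "(\<lambda>n. norm (eta_exp z ((6 * n + 1)\<^sup>2))) summable_on UNIV"
proof -
  define f where "f = (\<lambda>n. (if even n then 1 else -1) * eta_exp z ((6 * n + 1)\<^sup>2))"
  define r where "r = pi * Im z / 12"
  have r: "r > 0" using z by (simp add: r_def)
  have "(\<lambda>u::int. exp (- r * (of_int u)\<^sup>2)) summable_on range (\<lambda>n. 6 * n + 1)"
    using gaussian_summable_int[OF r] by (rule summable_on_subset) auto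
  then show norm_sum: "(\<lambda>n. norm (eta_exp z ((6 * n + 1)\<^sup>2))) summable_on UNIV"
    by (subst (asm) summable_on_reindex) (auto simp: inj_on_def o_def norm_eta_exp r_def)
  then have "(\<lambda>n. norm (f n)) summable_on UNIV"
    by (rule summable_on_cong[THEN iffD1, rotated]) (auto simp: f_def norm_mult)
  then have "f summable_on UNIV" by (rule abs_summable_summable)
  then obtain S where S: "(f has_sum S) UNIV" by (auto simp: summable_on_def)
  from has_sum_int_symmetric_limit[OF S] have lim: "(\<lambda>n. \<Sum>k\<in>{- int n..int n}. f k) \<longlonglongrightarrow> S" .
  define q where "q = nome z"
  have q: "norm q < 1" unfolding q_def by (rule norm_nome_less_1[OF z])
  \<comment> \<open>Enlarging the interval adds the indices s and -s, which match the two powers in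
    the pentagonal summand.\<close>
  have "(\<Sum>k\<in>{- int n..int n}. f k) = eta_exp z 1 *
     (1 + (\<Sum>s=1..n. (-1) ^ s * (q ^ (s * (3 * s - 1) div 2) + q ^ (s * (3 * s + 1) div 2))))" for n
  proof (induction n)
    case 0
    show ?case by (simp add: f_def)
  next
    case (Suc n)
    have q_nat: "q ^ k = eta_exp z (24 * int k)" for k
      using nome_powi[of z "int k"] by (simp add: q_def)
    have "{- int (Suc n)..int (Suc n)} = insert (- int (Suc n)) (insert (int (Suc n)) {- int n..int n})"
      by auto
    then have "(\<Sum>k\<in>{- int (Suc n)..int (Suc n)}. f k) =
        f (- int (Suc n)) + f (int (Suc n)) + (\<Sum>k\<in>{- int n..int n}. f k)"
      by simp
    moreover have "f (int (Suc n)) = eta_exp z 1 * ((-1) ^ Suc n * q ^ (Suc n * (3 * Suc n + 1) div 2))"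
    proof -
      define k where "k = Suc n * (3 * Suc n + 1) div 2"
      have "even (Suc n * (3 * Suc n + 1))" by auto
      then have "2 * k = Suc n * (3 * Suc n + 1)" unfolding k_def by (rule dvd_mult_div_cancel)
      then have "2 * int k = int (Suc n * (3 * Suc n + 1))" by linarith
      then have "1 + 12 * (2 * int k) = (6 * int (Suc n) + 1)\<^sup>2"
        by (simp only:) (simp add: power2_eq_square algebra_simps)
      then have "1 + 24 * int k = (6 * int (Suc n) + 1)\<^sup>2"
        by linarith
      then have e: "eta_exp z 1 * q ^ k = eta_exp z ((6 * int (Suc n) + 1)\<^sup>2)"
        unfolding q_nat eta_exp_add[symmetric] by simp
      show ?thesis unfolding f_def e[symmetric] k_def[symmetric]
        by (simp add: minus_one_power_iff)
    qed
    moreover have "f (- int (Suc n)) = eta_exp z 1 * ((-1) ^ Suc n * q ^ (Suc n * (3 * Suc n - 1) div 2))"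
    proof -
      define k where "k = Suc n * (3 * Suc n - 1) div 2"
      have "even (Suc n * (3 * Suc n - 1))" by auto
      then have "2 * k = Suc n * (3 * Suc n - 1)" unfolding k_def by (rule dvd_mult_div_cancel)
      then have "2 * int k = int (Suc n * (3 * Suc n - 1))" by linarith
      then have "1 + 12 * (2 * int k) = (6 * (- int (Suc n)) + 1)\<^sup>2"
        by (simp only:) (simp add: power2_eq_square algebra_simps)
      then have "1 + 24 * int k = (6 * (- int (Suc n)) + 1)\<^sup>2"
        by linarith
      then have e: "eta_exp z 1 * q ^ k = eta_exp z ((6 * (- int (Suc n)) + 1)\<^sup>2)"
        unfolding q_nat eta_exp_add[symmetric] by simp
      show ?thesis unfolding f_def e[symmetric] k_def[symmetric]
        by (simp add: minus_one_power_iff)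
    qed
    ultimately show ?case using Suc.IH by (simp add: algebra_simps del: of_nat_Suc)
  qed
  then have "(\<lambda>n. \<Sum>k\<in>{- int n..int n}. f k) \<longlonglongrightarrow> eta_exp z 1 * euler_phi q"
    using tendsto_mult[OF tendsto_const pentagonal_LIMSEQ[OF q]] by simp
  also have "eta_exp z 1 * euler_phi q = dedekind_eta z"
    by (simp add: dedekind_eta_altdef eta_exp_def q_def)
  finally have "S = dedekind_eta z" using lim LIMSEQ_unique by blast
  with S show "((\<lambda>n. (if even n then 1 else -1) * eta_exp z ((6 * n + 1)\<^sup>2)) has_sum dedekind_eta z) UNIV"
    by (simp add: f_def)
qed

section \<open>The eta product as a difference of theta functions\<close>

lemma norm_product_summable:
  assumes "Im z > 0" "D > 0"
  shows "(\<lambda>(u::int, y::int). norm (eta_exp z (u\<^sup>2 + int D * y\<^sup>2))) summable_on UNIV"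
  using gaussian_summable_int2[of "pi * Im z / 12" "pi * Im z * D / 12"] assms
  by (simp add: norm_eta_exp case_prod_unfold algebra_simps)

lemma eta_product_series:
  assumes z: "Im z > 0" and D: "D > 0"
  shows "((\<lambda>(m, n). (if even (m + n) then 1 else -1) * eta_exp z ((6 * m + 1)\<^sup>2 + int D * (6 * n + 1)\<^sup>2))
           has_sum (dedekind_eta z * dedekind_eta (of_nat D * z))) UNIV"
proof -
  have z': "Im (of_nat D * z) > 0" using z D by simp
  define f where "f = (\<lambda>n. (if even n then 1 else -1) * eta_exp z ((6 * n + 1)\<^sup>2))"
  define g where "g = (\<lambda>n. (if even n then 1 else -1) * eta_exp (of_nat D * z) ((6 * n + 1)\<^sup>2))"
  have f: "(f has_sum dedekind_eta z) UNIV" and g: "(g has_sum dedekind_eta (of_nat D * z)) UNIV"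
    unfolding f_def g_def by (rule eta_series z z')+
  have eq: "(if even (m + n) then 1 else -1) * eta_exp z ((6 * m + 1)\<^sup>2 + int D * (6 * n + 1)\<^sup>2) = f m * g n" for m n
    by (auto simp: f_def g_def eta_exp_add) (auto simp: eta_exp_def algebra_simps)
  have "(\<lambda>(m, n). norm (f m) * norm (g n)) summable_on UNIV \<times> UNIV"
  proof (rule summable_on_Times_mult)
    show "(\<lambda>n. norm (f n)) summable_on UNIV"
      by (rule summable_on_cong[THEN iffD1, OF _ eta_series(2)[OF z]]) (simp add: f_def norm_mult)
    show "(\<lambda>n. norm (g n)) summable_on UNIV"
      by (rule summable_on_cong[THEN iffD1, OF _ eta_series(2)[OF z']]) (simp add: g_def norm_mult)
  qed auto
  then have "(\<lambda>x. norm ((\<lambda>(m, n). f m * g n) x)) summable_on UNIV \<times> UNIV"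
    by (simp add: norm_mult case_prod_unfold)
  then have "(\<lambda>(m, n). f m * g n) summable_on UNIV \<times> UNIV"
    by (rule abs_summable_summable)
  then have "((\<lambda>(m, n). f m * g n) has_sum (dedekind_eta z * dedekind_eta (of_nat D * z))) (UNIV \<times> UNIV)"
    by (intro has_sum_SigmaI[OF _ has_sum_cmult_left[OF f]]) (auto intro!: has_sum_cmult_right g)
  then show ?thesis by (simp only: eq UNIV_Times_UNIV)
qed

text \<open>The vectors are sorted by y mod 6, after reflecting the second lattice. In the even
  classes the two lattices coincide, the class 3 is exchanged by u to -u, and 5 is the negative of
  1, whence the factor 2. In class 1 the lattices consist of the vectors (6m + 1, 6n + 1) with m + n
  even and odd respectively, which is the sign in \<open>eta_product_series\<close>.\<close>

theorem eta_product_eq_half_diff: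
  assumes z: "Im z > 0" and D: "D > 0"
  defines "w \<equiv> (\<lambda>(u, y). eta_exp z (u\<^sup>2 + int D * y\<^sup>2))"
  shows "2 * (dedekind_eta z * dedekind_eta (of_nat D * z)) =
           infsum w {(u, y). 12 dvd u - y} - infsum w {(u, y). 12 dvd u - 5 * y}"
proof -
  have norm_sum: "(\<lambda>x. norm (w x)) summable_on UNIV"
    using norm_product_summable[OF z D] by (simp add: w_def case_prod_unfold)
  have w_sum: "w summable_on A" for A
    using abs_summable_summable[OF norm_sum] summable_on_subset by blast
  have Un: "infsum w {x. (P x \<or> Q x)} = infsum w {x. P x} + infsum w {x. Q x}"
    if "\<And>x. P x \<Longrightarrow> Q x \<Longrightarrow> False" for P Q
  proof -
    have "{x. P x} \<inter> {x. Q x} = {}" using that by blast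
    then show ?thesis using infsum_Un_disjoint[OF w_sum w_sum, of "{x. P x}" "{x. Q x}"]
      by (simp add: Collect_disj_eq)
  qed
  have neg: "infsum w {x. P x} = infsum w {x. Q x}"
    if "\<And>u y. Q (u, y) = P (- u, - y)" for P Q
    by (rule infsum_reindex_bij_witness[of _ "\<lambda>(u, y). (- u, - y)" "\<lambda>(u, y). (- u, - y)"])
      (use that in \<open>auto simp: w_def\<close>)
  have flip: "infsum w {x. P x} = infsum w {x. Q x}"
    if "\<And>u y. Q (u, y) = P (- u, y)" for P Q
    by (rule infsum_reindex_bij_witness[of _ "\<lambda>(u, y). (- u, y)" "\<lambda>(u, y). (- u, y)"])
      (use that in \<open>auto simp: w_def\<close>)
  \<comment> \<open>\<open>Y\<close> is the mirror image of the second lattice under u to -u. The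
    weight is even in u, and in this form the even classes agree as sets.\<close>
  define X Y where "X = (\<lambda>(u::int, y::int). 12 dvd u - y)" and "Y = (\<lambda>(u::int, y::int). 12 dvd u + 5 * y)"
  define c where "c = (\<lambda>(u::int, y::int). y mod 6)"
  have split: "infsum w {x. P x} = infsum w {x. P x \<and> c x = 1} + infsum w {x. P x \<and> c x = 5}
      + infsum w {x. P x \<and> (c x = 0 \<or> c x = 2 \<or> c x = 4)} + infsum w {x. P x \<and> c x = 3}" for P
  proof -
    have "c x \<in> {0,1,2,3,4,5}" for x
    proof (cases x)
      case (Pair u y)
      have "0 \<le> y mod 6" "y mod 6 < 6" by auto
      then show ?thesis unfolding Pair c_def by auto
    qed
    then have "{x. P x} = {x. ((P x \<and> c x = 1 \<or> P x \<and> c x = 5) \<or> P x \<and> (c x = 0 \<or> c x = 2 \<or> c x = 4)) \<or> P x \<and> c x = 3}"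
      by blast
    then have e0: "infsum w {x. P x} = infsum w {x. ((P x \<and> c x = 1 \<or> P x \<and> c x = 5) \<or> P x \<and> (c x = 0 \<or> c x = 2 \<or> c x = 4)) \<or> P x \<and> c x = 3}"
      by (rule arg_cong)
    have e1: "infsum w {x. ((P x \<and> c x = 1 \<or> P x \<and> c x = 5) \<or> P x \<and> (c x = 0 \<or> c x = 2 \<or> c x = 4)) \<or> P x \<and> c x = 3} =
        infsum w {x. (P x \<and> c x = 1 \<or> P x \<and> c x = 5) \<or> P x \<and> (c x = 0 \<or> c x = 2 \<or> c x = 4)}
        + infsum w {x. P x \<and> c x = 3}"
      by (rule Un) auto
    have e2: "infsum w {x. (P x \<and> c x = 1 \<or> P x \<and> c x = 5) \<or> P x \<and> (c x = 0 \<or> c x = 2 \<or> c x = 4)} =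
        infsum w {x. P x \<and> c x = 1 \<or> P x \<and> c x = 5} + infsum w {x. P x \<and> (c x = 0 \<or> c x = 2 \<or> c x = 4)}"
      by (rule Un) auto
    have e3: "infsum w {x. P x \<and> c x = 1 \<or> P x \<and> c x = 5} =
        infsum w {x. P x \<and> c x = 1} + infsum w {x. P x \<and> c x = 5}"
      by (rule Un) auto
    show ?thesis by (rule trans[OF e0[unfolded e1 e2 e3]]) (rule refl)
  qed
  have X5: "infsum w {x. X x \<and> c x = 5} = infsum w {x. X x \<and> c x = 1}"
  proof (rule neg)
    fix u y :: int
    have "12 dvd - u + y \<longleftrightarrow> 12 dvd u - y" using dvd_minus_iff[of 12 "u - y"] by simp
    moreover have "(- y) mod 6 = 5 \<longleftrightarrow> y mod 6 = 1" by presburger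
    ultimately show "(X (u, y) \<and> c (u, y) = 1) = (X (- u, - y) \<and> c (- u, - y) = 5)"
      unfolding X_def c_def by simp
  qed
  have Y5: "infsum w {x. Y x \<and> c x = 5} = infsum w {x. Y x \<and> c x = 1}"
  proof (rule neg)
    fix u y :: int
    have "12 dvd - (5 * y) - u \<longleftrightarrow> 12 dvd u + 5 * y" 
      using dvd_minus_iff[of 12 "u + 5 * y"] by (simp only: minus_add_distrib uminus_add_conv_diff add.commute)
    moreover have "(- y) mod 6 = 5 \<longleftrightarrow> y mod 6 = 1" by presburger
    ultimately show "(Y (u, y) \<and> c (u, y) = 1) = (Y (- u, - y) \<and> c (- u, - y) = 5)"
      unfolding Y_def c_def by simp
  qed
  \<comment> \<open>The two quantities differ by 6 y, a multiple of 12 for even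
    \<open>y\<close>.\<close>
  have even: "{x. X x \<and> (c x = 0 \<or> c x = 2 \<or> c x = 4)} = {x. Y x \<and> (c x = 0 \<or> c x = 2 \<or> c x = 4)}"
  proof (intro Collect_cong)
    fix x :: "int \<times> int"
    obtain u y where x: "x = (u, y)" by (cases x)
    have "12 dvd u - y \<longleftrightarrow> 12 dvd u + 5 * y" if "even y"
    proof -
      from that obtain k where "y = 2 * k" by blast
      then have "u + 5 * y = u - y + 12 * k" by simp
      then show ?thesis by (metis dvd_add_left_iff dvd_triv_left)
    qed
    moreover have "even y" if "y mod 6 = 0 \<or> y mod 6 = 2 \<or> y mod 6 = 4" using that by presburger
    ultimately show "(X x \<and> (c x = 0 \<or> c x = 2 \<or> c x = 4)) = (Y x \<and> (c x = 0 \<or> c x = 2 \<or> c x = 4))"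
      unfolding x X_def Y_def c_def by auto
  qed
  \<comment> \<open>The quantities \<open>- u - y\<close> and \<open>u + 5 * y\<close> add up to 4
    y, a multiple of 12 when \<open>y mod 6 = 3\<close>.\<close>
  have three: "infsum w {x. X x \<and> c x = 3} = infsum w {x. Y x \<and> c x = 3}"
  proof (rule flip)
    fix u y :: int
    have "12 dvd - u - y \<longleftrightarrow> 12 dvd u + 5 * y" if "y mod 6 = 3"
    proof -
      have "y = 6 * (y div 6) + 3" using that by presburger
      then have "u + 5 * y = - (- u - y) + 12 * (2 * (y div 6) + 1)" by simp
      then show ?thesis by (metis dvd_add_left_iff dvd_triv_left dvd_minus_iff)
    qed
    then show "(Y (u, y) \<and> c (u, y) = 3) = (X (- u, y) \<and> c (- u, y) = 3)"
      unfolding X_def Y_def c_def by auto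
  qed
  have Y_flip: "infsum w {x. Y x} = infsum w {(u, y). 12 dvd u - 5 * y}"
  proof -
    have "infsum w {x. Y x} = infsum w {x. (\<lambda>(u, y). 12 dvd u - 5 * y) x}"
    proof (rule flip)
      fix u y :: int
      show "(case (u, y) of (u, y) \<Rightarrow> 12 dvd u - 5 * y) = Y (- u, y)"
        using dvd_minus_iff[of 12 "u - 5 * y"] unfolding Y_def by simp
    qed
    then show ?thesis by (simp add: case_prod_unfold)
  qed
  have "infsum w {x. X x} - infsum w {x. Y x} = 2 * (infsum w {x. X x \<and> c x = 1} - infsum w {x. Y x \<and> c x = 1})"
    unfolding split[of X] split[of Y] X5 Y5 even three by (simp add: algebra_simps)
  also have "infsum w {x. X x \<and> c x = 1} - infsum w {x. Y x \<and> c x = 1} =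
      dedekind_eta z * dedekind_eta (of_nat D * z)"
  proof -
    define h where "h = (\<lambda>(m::int, n::int). (6 * m + 1, 6 * n + 1))"
    have inj: "inj_on h A" for A by (auto simp: h_def inj_on_def)
    \<comment> \<open>With y = 6n + 1 and u - y = 12k one gets u = 6m + 1 for m = n + 2k, of the
      same parity as n; in \<open>imgY\<close> the index m = 2k - 5n - 1 has the opposite
      parity.\<close>
    have imgX: "{x. X x \<and> c x = 1} = h ` {(m, n). even (m + n)}"
    proof (intro equalityI subsetI)
      fix x assume "x \<in> {x. X x \<and> c x = 1}"
      then obtain u y where x: "x = (u, y)" "12 dvd u - y" "y mod 6 = 1" by (cases x) (auto simp: X_def c_def)
      then obtain k where "u - y = 12 * k" by blast
      moreover obtain n where "y = 6 * n + 1" using x by (metis mult_div_mod_eq)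
      ultimately have "u = 6 * (n + 2 * k) + 1" "y = 6 * n + 1" by simp_all
      then show "x \<in> h ` {(m, n). even (m + n)}"
        unfolding x h_def by (intro image_eqI[of _ _ "(n + 2 * k, n)"]) auto
    next
      fix x assume "x \<in> h ` {(m, n). even (m + n)}"
      then obtain m n where x: "x = (6 * m + 1, 6 * n + 1)" "even (m + n)" by (auto simp: h_def)
      then obtain j where "m + n = 2 * j" by blast
      then have "(6 * m + 1) - (6 * n + 1) = 12 * (j - n)" by simp
      then have "12 dvd (6 * m + 1) - (6 * n + 1)" by (metis dvd_triv_left)
      moreover have "(6 * n + 1) mod 6 = 1" by presburger
      ultimately show "x \<in> {x. X x \<and> c x = 1}" using x by (auto simp: X_def c_def)
    qed
    have imgY: "{x. Y x \<and> c x = 1} = h ` {(m, n). odd (m + n)}"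
    proof (intro equalityI subsetI)
      fix x assume "x \<in> {x. Y x \<and> c x = 1}"
      then obtain u y where x: "x = (u, y)" "12 dvd u + 5 * y" "y mod 6 = 1" by (cases x) (auto simp: Y_def c_def)
      then obtain k where "u + 5 * y = 12 * k" by blast
      moreover obtain n where "y = 6 * n + 1" using x by (metis mult_div_mod_eq)
      ultimately have "u = 6 * (2 * k - 5 * n - 1) + 1" "y = 6 * n + 1" by simp_all
      then show "x \<in> h ` {(m, n). odd (m + n)}"
        unfolding x h_def by (intro image_eqI[of _ _ "(2 * k - 5 * n - 1, n)"]) auto
    next
      fix x assume "x \<in> h ` {(m, n). odd (m + n)}"
      then obtain m n where x: "x = (6 * m + 1, 6 * n + 1)" "odd (m + n)" by (auto simp: h_def)
      obtain j where "m + n = 2 * j + 1" using x(2) by (rule oddE)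
      then have "(6 * m + 1) + 5 * (6 * n + 1) = 12 * (j + 2 * n + 1)" by simp
      then have "12 dvd (6 * m + 1) + 5 * (6 * n + 1)" by (metis dvd_triv_left)
      moreover have "(6 * n + 1) mod 6 = 1" by presburger
      ultimately show "x \<in> {x. Y x \<and> c x = 1}" using x by (auto simp: Y_def c_def)
    qed
    define F where "F = (\<lambda>(m, n). (if even (m + n) then 1 else -1) * eta_exp z ((6 * m + 1)\<^sup>2 + int D * (6 * n + 1)\<^sup>2))"
    have F: "(F has_sum (dedekind_eta z * dedekind_eta (of_nat D * z))) UNIV"
      unfolding F_def by (rule eta_product_series[OF z D])
    have FX: "((\<lambda>x. F x) has_sum infsum w {x. X x \<and> c x = 1}) {(m, n). even (m + n)}"
    proof -
      have "(w has_sum infsum w {x. X x \<and> c x = 1}) (h ` {(m, n). even (m + n)})"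
        unfolding imgX[symmetric] by (intro has_sum_infsum w_sum)
      then have "((w \<circ> h) has_sum infsum w {x. X x \<and> c x = 1}) {(m, n). even (m + n)}"
        by (simp add: has_sum_reindex[OF inj])
      then show ?thesis
        by (rule has_sum_cong[THEN iffD1, rotated]) (auto simp: F_def w_def h_def)
    qed
    have FY: "((\<lambda>x. F x) has_sum - infsum w {x. Y x \<and> c x = 1}) {(m, n). odd (m + n)}"
    proof -
      have "(w has_sum infsum w {x. Y x \<and> c x = 1}) (h ` {(m, n). odd (m + n)})"
        unfolding imgY[symmetric] by (intro has_sum_infsum w_sum)
      then have "((w \<circ> h) has_sum infsum w {x. Y x \<and> c x = 1}) {(m, n). odd (m + n)}"
        by (simp add: has_sum_reindex[OF inj])
      then have "((\<lambda>x. - (w \<circ> h) x) has_sum - infsum w {x. Y x \<and> c x = 1}) {(m, n). odd (m + n)}"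
        by (simp add: has_sum_uminus o_def)
      then show ?thesis
        by (rule has_sum_cong[THEN iffD1, rotated]) (auto simp: F_def w_def h_def)
    qed
    have "((\<lambda>x. F x) has_sum (infsum w {x. X x \<and> c x = 1} + - infsum w {x. Y x \<and> c x = 1}))
        ({(m, n). even (m + n)} \<union> {(m, n). odd (m + n)})"
      by (rule has_sum_Un_disjoint[OF FX FY]) auto
    moreover have "{(m, n). even (m + n)} \<union> {(m, n). odd (m + n)} = (UNIV :: (int \<times> int) set)" by auto
    ultimately show ?thesis using F has_sum_unique by fastforce
  qed
  finally show ?thesis by (simp add: Y_flip) (simp add: X_def case_prod_unfold)
qed

section \<open>Theta functions of positive definite forms\<close>

lemma qeval_int: "qeval Q x y = qa Q * x\<^sup>2 + qb Q * x * y + qc Q * y\<^sup>2" for x y :: int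
  by (simp add: qeval_def)

text \<open>Completing the square; this underlies summability, finiteness of representations,
  nonnegativity and the bound on \<open>rep_count\<close>.\<close>

lemma four_a_qeval:
  "4 * qa Q * qeval Q x y = (2 * qa Q * x + qb Q * y)\<^sup>2 - discriminant Q * y\<^sup>2" for x y :: int
  unfolding qeval_def discriminant_def by (simp add: power2_eq_square algebra_simps)

lemma four_a_qeval_real:
  "4 * of_int (qa Q) * qeval Q x y =
     (2 * of_int (qa Q) * x + of_int (qb Q) * y)\<^sup>2 - of_int (discriminant Q) * y\<^sup>2" for x y :: real
  unfolding qeval_def discriminant_def by (simp add: power2_eq_square algebra_simps)

lemma positive_definiteI:
  assumes "qa Q > 0" "discriminant Q < 0"
  shows "positive_definite Q"
  unfolding positive_definite_def
proof (intro allI impI)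
  fix x y :: real assume xy: "(x, y) \<noteq> (0, 0)"
  let ?a = "of_int (qa Q) :: real" and ?d = "of_int (discriminant Q) :: real"
  have "(2 * ?a * x + of_int (qb Q) * y)\<^sup>2 - ?d * y\<^sup>2 > 0"
  proof (cases "y = 0")
    case True
    then show ?thesis using xy assms by simp
  next
    case False
    then have "?d * y\<^sup>2 < 0" using assms by (intro mult_neg_pos) auto
    then show ?thesis by (smt (verit) zero_le_power2)
  qed
  then have "4 * ?a * qeval Q x y > 0" by (simp only: four_a_qeval_real)
  then show "qeval Q x y > 0" using assms by (simp add: zero_less_mult_iff)
qed

lemma positive_definite_qa_pos: "positive_definite Q \<Longrightarrow> qa Q > 0"
  unfolding positive_definite_def by (drule spec[of _ 1], drule spec[of _ 0]) (simp add: qeval_def)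

lemma inj_complete_square: "qa Q \<noteq> 0 \<Longrightarrow> inj_on (\<lambda>(x, y). (2 * qa Q * x + qb Q * y, y)) A"
  by (auto simp: inj_on_def)

text \<open>Under the injective substitution (x, y) to (2ax + by, y) the norms are exactly terms of
  the Gaussian double sum with rates \<open>r\<close> and \<open>s\<close>.\<close>

lemma theta_summable:
  assumes Q: "qa Q > 0" "discriminant Q < 0" and z: "Im z > 0"
  shows "(\<lambda>(x, y). norm (nome z powi qeval Q x y)) summable_on (UNIV :: (int \<times> int) set)"
proof -
  define r where "r = 2 * pi * Im z / (4 * real_of_int (qa Q))"
  define s where "s = r * - real_of_int (discriminant Q)"
  define h where "h = (\<lambda>(x, y). (2 * qa Q * x + qb Q * y, y))"
  have r: "r > 0" using Q z by (simp add: r_def)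
  then have s: "s > 0" using Q by (simp add: s_def mult_pos_neg)
  have "(\<lambda>(u::int, y::int). exp (- r * (of_int u)\<^sup>2 - s * (of_int y)\<^sup>2)) summable_on range h"
    using gaussian_summable_int2[OF r s] by (rule summable_on_subset) auto
  then have "((\<lambda>(u::int, y::int). exp (- r * (of_int u)\<^sup>2 - s * (of_int y)\<^sup>2)) \<circ> h) summable_on UNIV"
    using inj_complete_square[of Q UNIV] Q by (subst (asm) summable_on_reindex) (auto simp: h_def)
  then show ?thesis
  proof (rule summable_on_cong[THEN iffD1, rotated])
    fix p :: "int \<times> int"
    obtain x y where p: "p = (x, y)" by (cases p)
    define m where "m = qeval Q x y"
    have "real_of_int (4 * qa Q * m) = real_of_int ((2 * qa Q * x + qb Q * y)\<^sup>2 - discriminant Q * y\<^sup>2)"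
      unfolding m_def four_a_qeval ..
    then have m: "of_int m = ((real_of_int (2 * qa Q * x + qb Q * y))\<^sup>2 - of_int (discriminant Q) * (of_int y)\<^sup>2) / (4 * of_int (qa Q))"
      using Q by (simp add: field_simps)
    have "norm (nome z powi m) = exp (- (2 * pi * Im z) * of_int m)"
      by (simp add: nome_powi norm_eta_exp)
    also have "- (2 * pi * Im z) * of_int m = - r * (of_int (2 * qa Q * x + qb Q * y))\<^sup>2 - s * (of_int y)\<^sup>2"
      unfolding m r_def s_def using Q by (simp add: field_simps)
    finally show "((\<lambda>(u::int, y::int). exp (- r * (of_int u)\<^sup>2 - s * (of_int y)\<^sup>2)) \<circ> h) p =
        (case p of (x, y) \<Rightarrow> norm (nome z powi qeval Q x y))"
      by (simp add: p h_def m_def)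
  qed
qed

lemma form_theta_cong_unimodular:
  assumes det: "\<bar>p * s - q * r\<bar> = (1::int)"
    and eq: "\<And>x y :: int. qeval Q1 x y = qeval Q2 (p * x + q * y) (r * x + s * y)"
  shows "form_theta Q1 z = form_theta Q2 z"
proof -
  define d where "d = p * s - q * r"
  \<comment> \<open>The inverse matrix: the adjugate times \<open>d\<close>, since 1/d = d for d = 1
    and d = -1.\<close>
  define i where "i = (\<lambda>(x::int, y::int). (d * (s * x - q * y), d * (p * y - r * x)))"
  define j where "j = (\<lambda>(x::int, y::int). (p * x + q * y, r * x + s * y))"
  have d: "d * d = 1" using det by (metis abs_mult_self_eq d_def mult_1)
  have ij: "i (j a) = a" for a
  proof (cases a)
    case (Pair x y)
    have "i (j a) = ((d * d) * x, (d * d) * y)"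
      unfolding Pair i_def j_def d_def by (simp add: algebra_simps)
    then show ?thesis by (simp add: d Pair)
  qed
  have ji: "j (i a) = a" for a
  proof (cases a)
    case (Pair x y)
    have "j (i a) = ((d * d) * x, (d * d) * y)"
      unfolding Pair i_def j_def d_def by (simp add: algebra_simps)
    then show ?thesis by (simp add: d Pair)
  qed
  show ?thesis unfolding form_theta_def
    by (rule infsum_reindex_bij_witness[of _ i j]) (auto simp: ij ji, auto simp: j_def eq)
qed

lemma form_theta_properly_equivalent:
  "properly_equivalent Q1 Q2 \<Longrightarrow> form_theta Q1 z = form_theta Q2 z"
  unfolding properly_equivalent_def using form_theta_cong_unimodular by (metis abs_one)

lemma form_theta_flip_b: "form_theta (QForm a (- b) c) z = form_theta (QForm a b c) z"
  by (rule form_theta_cong_unimodular[of 1 "-1" 0 0]) (auto simp: qeval_def power2_eq_square)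

text \<open>Valid also for \<open>k < 6\<close>, where the first form is not reduced; the tabulated
  small pairs are derived from this.\<close>

theorem eta_product_theta:
  assumes D: "int D + 1 = 24 * k" and z: "Im z > 0"
  shows "dedekind_eta z * dedekind_eta (of_nat D * z) = half_theta_diff (QForm 6 1 k) (QForm 6 5 (k + 1)) z"
proof -
  have D0: "D > 0" using D by (cases "D = 0") presburger+
  define w where "w = (\<lambda>(u, y). eta_exp z (u\<^sup>2 + int D * y\<^sup>2))"
  have D': "int D = 24 * k - 1" using D by simp
  \<comment> \<open>Since 24 (6x^2 + xy + ky^2) = (12x + y)^2 + Dy^2 and 24 (6x^2 + 5xy + (k+1)y^2)
    = (12x + 5y)^2 + Dy^2, the substitutions u = 12x + y and u = 12x + 5y carry all integer vectors
    onto the two lattices.\<close>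
  have 1: "form_theta (QForm 6 1 k) z = infsum w {(u, y). 12 dvd u - y}"
    unfolding form_theta_def
    by (rule infsum_reindex_bij_witness[of _ "\<lambda>(u, y). ((u - y) div 12, y)" "\<lambda>(x, y). (12 * x + y, y)"])
      (auto simp: w_def nome_powi qeval_int D' power2_eq_square algebra_simps)
  have 5: "form_theta (QForm 6 5 (k + 1)) z = infsum w {(u, y). 12 dvd u - 5 * y}"
    unfolding form_theta_def
    by (rule infsum_reindex_bij_witness[of _ "\<lambda>(u, y). ((u - 5 * y) div 12, y)" "\<lambda>(x, y). (12 * x + 5 * y, y)"])
      (auto simp: w_def nome_powi qeval_int D' power2_eq_square algebra_simps)
  show ?thesis unfolding half_theta_diff_def 1 5 w_def
    using eta_product_eq_half_diff[OF z D0] by (simp add: field_simps)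
qed

section \<open>Representation numbers as coefficients of theta series\<close>

text \<open>Opposite vectors count separately. The default 0 of \<open>card\<close> on infinite sets
  never enters for positive definite forms, by \<open>finite_representations\<close>.\<close>

definition rep_count :: "qform \<Rightarrow> nat \<Rightarrow> nat" where
  "rep_count Q n = card {(x, y). qeval Q x y = int n}"

lemma finite_representations:
  assumes Q: "qa Q > 0" "discriminant Q < 0"
  shows "finite {(x::int, y). qeval Q x y = n}"
proof -
  define h where "h = (\<lambda>(x, y). (2 * qa Q * x + qb Q * y, y))"
  define M where "M = 4 * qa Q * n"
  have "h ` {(x, y). qeval Q x y = n} \<subseteq> {-M..M} \<times> {-M..M}"
  proof safe
    fix u v x y assume n: "n = qeval Q x y" and h: "(u, v) = h (x, y)"
    then have "M = u\<^sup>2 + - discriminant Q * v\<^sup>2" unfolding M_def h_def using four_a_qeval[of Q x y] by simp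
    moreover have "v\<^sup>2 \<le> - discriminant Q * v\<^sup>2" using Q by (simp add: mult_le_cancel_right1 flip: mult_minus_left)
    ultimately have "u\<^sup>2 \<le> M" "v\<^sup>2 \<le> M" by (smt (verit) zero_le_power2)+
    moreover have "\<bar>t\<bar> \<le> t\<^sup>2" for t :: int
      using self_le_power[of "\<bar>t\<bar>" 2] by (cases "t = 0") auto
    ultimately have "\<bar>u\<bar> \<le> M" "\<bar>v\<bar> \<le> M" using order_trans by blast+
    then show "u \<in> {-M..M}" "v \<in> {-M..M}" by auto
  qed
  then have "finite (h ` {(x, y). qeval Q x y = n})" by (rule finite_subset) simp
  then show ?thesis using inj_complete_square[of Q] Q unfolding h_def by (simp add: finite_image_iff)
qed

lemma qeval_nonneg:
  assumes "qa Q > 0" "discriminant Q < 0"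
  shows "qeval Q x y \<ge> (0::int)"
proof -
  have "discriminant Q * y\<^sup>2 \<le> 0" using assms by (simp add: mult_nonpos_nonneg)
  then have "4 * qa Q * qeval Q x y \<ge> 0" unfolding four_a_qeval by (smt (verit) zero_le_power2)
  then show ?thesis using assms by (simp add: zero_le_mult_iff)
qed

text \<open>Groups the absolutely convergent double sum by the value of the form; \<open>nat\<close>
  loses nothing, these values being nonnegative. This gives a power series in q whose coefficients
  can be compared.\<close>

lemma form_theta_sums:
  assumes Q: "qa Q > 0" "discriminant Q < 0" and z: "Im z > 0"
  shows "(\<lambda>n. of_nat (rep_count Q n) * nome z ^ n) sums form_theta Q z"
proof -
  define f where "f = (\<lambda>(x::int, y::int). nome z powi qeval Q x y)"
  have "(\<lambda>p. norm (f p)) summable_on UNIV"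
    using theta_summable[OF assms] by (simp add: f_def case_prod_unfold)
  then have "f summable_on UNIV" by (rule abs_summable_summable)
  then have f: "(f has_sum form_theta Q z) UNIV"
    unfolding form_theta_def f_def by (rule has_sum_infsum)
  define fib where "fib = (\<lambda>n. {(x::int, y). qeval Q x y = int n})"
  have "((\<lambda>(n, p). f p) has_sum form_theta Q z) (Sigma UNIV fib)"
  proof (rule has_sum_reindex_bij_witness[THEN iffD1, OF _ _ _ _ _ _ f])
    fix p :: "int \<times> int"
    show "snd (nat (qeval Q (fst p) (snd p)), p) = p" by simp
    show "(nat (qeval Q (fst p) (snd p)), p) \<in> Sigma UNIV fib"
      by (auto simp: fib_def qeval_nonneg[OF Q])
    show "(case (nat (qeval Q (fst p) (snd p)), p) of (n, p) \<Rightarrow> f p) = f p" by simp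
  qed (auto simp: fib_def)
  then have "((\<lambda>n. of_nat (rep_count Q n) * nome z ^ n) has_sum form_theta Q z) UNIV"
  proof (rule has_sum_SigmaD)
    fix n
    have "((\<lambda>p. f p) has_sum (\<Sum>p\<in>fib n. f p)) (fib n)"
      unfolding fib_def by (intro has_sum_finite finite_representations Q)
    also have "(\<Sum>p\<in>fib n. f p) = (\<Sum>p\<in>fib n. nome z ^ n)"
      by (intro sum.cong) (auto simp: f_def fib_def)
    also have "\<dots> = of_nat (rep_count Q n) * nome z ^ n"
      by (simp add: rep_count_def fib_def)
    finally show "((\<lambda>p. case (n, p) of (n, p) \<Rightarrow> f p) has_sum of_nat (rep_count Q n) * nome z ^ n) (fib n)"
      by simp
  qed
  then show ?thesis by (rule has_sum_imp_sums)
qed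

section \<open>Representation numbers of reduced forms\<close>

lemma reduced_qa_pos:
  assumes "reduced_form Q" "discriminant Q < 0"
  shows "qa Q > 0"
  using assms unfolding reduced_form_def discriminant_def
  by (cases "qa Q = 0") (auto simp: power2_eq_square)

text \<open>From b^2 <= a^2 <= ac one gets 4ac - b^2 >= 3ac >= 3a^2.\<close>

lemma reduced_disc_bound:
  assumes "reduced_form Q" "discriminant Q < 0"
  shows "3 * (qa Q)\<^sup>2 \<le> - discriminant Q"
    and "3 * (qa Q * qc Q) \<le> - discriminant Q"
proof -
  have a: "0 < qa Q" by (rule reduced_qa_pos[OF assms])
  have "(qb Q)\<^sup>2 \<le> (qa Q)\<^sup>2" using assms(1) a unfolding reduced_form_def by (intro power2_le_iff_abs_le[THEN iffD2]) auto
  moreover have "(qa Q)\<^sup>2 \<le> qa Q * qc Q"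
    using assms(1) a unfolding reduced_form_def by (simp add: power2_eq_square)
  ultimately show "3 * (qa Q)\<^sup>2 \<le> - discriminant Q" "3 * (qa Q * qc Q) \<le> - discriminant Q"
    unfolding discriminant_def by linarith+
qed

text \<open>Since |b| <= a, the value is at least a (x^2 - |xy| + y^2) + (c - a) y^2, and the
  bracket is a positive integer once y is nonzero. Hence only multiples of (1, 0) take values below
  c.\<close>

lemma reduced_qeval_ge_qc:
  fixes x y :: int
  assumes "reduced_form Q" "discriminant Q < 0" "y \<noteq> 0"
  shows "qeval Q x y \<ge> qc Q"
proof -
  let ?a = "qa Q" and ?b = "qb Q" and ?c = "qc Q"
  have a: "0 < ?a" by (rule reduced_qa_pos[OF assms(1,2)])
  have red: "\<bar>?b\<bar> \<le> ?a" "?a \<le> ?c" using assms(1) by (auto simp: reduced_form_def)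
  have y: "1 \<le> y\<^sup>2" using assms(3) by (metis int_one_le_iff_zero_less zero_less_power2)
  have "\<bar>?b * (x * y)\<bar> \<le> ?a * \<bar>x * y\<bar>" unfolding abs_mult[of ?b] by (rule mult_right_mono) (use red in auto)
  then have b: "?b * x * y \<ge> - (?a * \<bar>x * y\<bar>)" by (simp add: mult.assoc)
  have "4 * (x\<^sup>2 - \<bar>x * y\<bar> + y\<^sup>2) = (2 * \<bar>x\<bar> - \<bar>y\<bar>)\<^sup>2 + 3 * y\<^sup>2"
    by (simp add: power2_eq_square abs_mult algebra_simps)
  then have "x\<^sup>2 - \<bar>x * y\<bar> + y\<^sup>2 \<ge> 1" using y by (smt (verit) zero_le_power2)
  then have "?a * 1 \<le> ?a * (x\<^sup>2 - \<bar>x * y\<bar> + y\<^sup>2)" using a by (intro mult_left_mono) auto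
  moreover have "(?c - ?a) * 1 \<le> (?c - ?a) * y\<^sup>2" using red y by (intro mult_left_mono) auto
  ultimately show ?thesis using b unfolding qeval_int by (simp add: algebra_simps)
qed

text \<open>Separates the multiples of (1, 0), whose number depends on the leading coefficient
  alone; two forms sharing it can differ only from the smaller last coefficient onwards.\<close>

lemma rep_count_split:
  assumes "reduced_form Q" "discriminant Q < 0"
  shows "rep_count Q n = card {x. qa Q * x\<^sup>2 = int n} + card {(x, y). y \<noteq> 0 \<and> qeval Q x y = int n}"
proof -
  have fin: "finite {(x::int, y). qeval Q x y = int n}"
    by (rule finite_representations[OF reduced_qa_pos[OF assms] assms(2)])
  have eq: "{(x::int, y). qeval Q x y = int n} =
      (\<lambda>x. (x, 0)) ` {x. qa Q * x\<^sup>2 = int n} \<union> {(x, y). y \<noteq> 0 \<and> qeval Q x y = int n}"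
    by (auto simp: qeval_int)
  have "rep_count Q n = card ((\<lambda>x. (x, 0::int)) ` {x. qa Q * x\<^sup>2 = int n}) + card {(x, y). y \<noteq> 0 \<and> qeval Q x y = int n}"
    unfolding rep_count_def eq
    by (rule card_Un_disjoint) (use fin[unfolded eq] in auto)
  also have "card ((\<lambda>x. (x, 0::int)) ` {x. qa Q * x\<^sup>2 = int n}) = card {x. qa Q * x\<^sup>2 = int n}"
    by (rule card_image) (auto simp: inj_on_def)
  finally show ?thesis .
qed

lemma rep_count_below_qc:
  assumes "reduced_form Q" "discriminant Q < 0" "int n < qc Q"
  shows "rep_count Q n = card {x. qa Q * x\<^sup>2 = int n}"
proof -
  have none: "{(x, y). y \<noteq> 0 \<and> qeval Q x y = int n} = {}"
  proof -
    have "qeval Q x y \<noteq> int n" if "y \<noteq> 0" for x y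
      using reduced_qeval_ge_qc[OF assms(1,2) that, of x] assms(3) by linarith
    then show ?thesis by auto
  qed
  show ?thesis unfolding rep_count_split[OF assms(1,2)] none by simp
qed

lemma rep_count_at_qc:
  assumes "reduced_form Q" "discriminant Q < 0" "int n = qc Q"
  shows "rep_count Q n > card {x. qa Q * x\<^sup>2 = int n}"
proof -
  have "finite {(x, y). y \<noteq> 0 \<and> qeval Q x y = int n}"
    by (rule finite_subset[OF _ finite_representations[OF reduced_qa_pos[OF assms(1,2)] assms(2), of "int n"]]) auto
  moreover have "(0, 1) \<in> {(x, y). y \<noteq> 0 \<and> qeval Q x y = int n}" by (simp add: qeval_int assms(3))
  ultimately have "card {(x, y). y \<noteq> 0 \<and> qeval Q x y = int n} > 0" using card_gt_0_iff by blast
  then show ?thesis unfolding rep_count_split[OF assms(1,2)] by simp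
qed

lemma card_quadratic_int_roots:
  fixes a b c :: int
  assumes "a \<noteq> 0"
  shows "finite {x. a * x\<^sup>2 + b * x = c}" "card {x. a * x\<^sup>2 + b * x = c} \<le> 2"
proof -
  have "\<exists>s t. {x. a * x\<^sup>2 + b * x = c} \<subseteq> {s, t}"
  proof (cases "{x. a * x\<^sup>2 + b * x = c} = {}")
    case False
    then obtain x0 where x0: "a * x0\<^sup>2 + b * x0 = c" by blast
    \<comment> \<open>By Vieta the other root is \<open>- b div a - x0\<close>; the division is
      exact because \<open>- b = a * (x + x0)\<close>.\<close>
    have "x = x0 \<or> x = - b div a - x0" if "a * x\<^sup>2 + b * x = c" for x
    proof -
      have "(x - x0) * (a * (x + x0) + b) = 0"
        using that x0 by (simp add: algebra_simps power2_eq_square)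
      then have "x = x0 \<or> - b = a * (x + x0)" by auto
      then show ?thesis using assms by auto
    qed
    then show ?thesis by blast
  qed blast
  then obtain s t where st: "{x. a * x\<^sup>2 + b * x = c} \<subseteq> {s, t}" by blast
  then show "finite {x. a * x\<^sup>2 + b * x = c}" by (rule finite_subset) simp
  have "card {x. a * x\<^sup>2 + b * x = c} \<le> card {s, t}" using st by (intro card_mono) auto
  then show "card {x. a * x\<^sup>2 + b * x = c} \<le> 2" by (rule order_trans) (simp add: card_insert_if)
qed

text \<open>Vectors with \<open>\<bar>y\<bar> \<ge> 2\<close> have \<open>4 a Q \<ge> D y\<^sup>2 \<ge> 4 D\<close>, so each of \<open>y = 0, 1, -1\<close> contributes
  the roots of one quadratic equation.\<close>

lemma rep_count_le_6:
  assumes a: "qa Q > 0" and "discriminant Q < 0" and n: "qa Q * int n < - discriminant Q"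
  shows "rep_count Q n \<le> 6"
proof -
  let ?R = "\<lambda>b c. {x. qa Q * x\<^sup>2 + b * x = c}"
  have R: "finite (?R b c)" "card (?R b c) \<le> 2" for b c
    using card_quadratic_int_roots[of "qa Q" b c] a by auto
  let ?U = "(\<lambda>x. (x, 0::int)) ` ?R 0 (int n) \<union> ((\<lambda>x. (x, 1)) ` ?R (qb Q) (int n - qc Q)
      \<union> (\<lambda>x. (x, -1)) ` ?R (- qb Q) (int n - qc Q))"
  have "{(x, y). qeval Q x y = int n} \<subseteq> ?U"
  proof
    fix p assume "p \<in> {(x::int, y). qeval Q x y = int n}"
    then obtain x y where p: "p = (x, y)" and xy: "qeval Q x y = int n" by auto
    have "\<bar>y\<bar> \<le> 1"
    proof (rule ccontr)
      assume "\<not> \<bar>y\<bar> \<le> 1"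
      then have "2\<^sup>2 \<le> y\<^sup>2" by (subst abs_le_square_iff[symmetric]) auto
      then have "- discriminant Q * 4 \<le> - discriminant Q * y\<^sup>2" using assms by (intro mult_left_mono) auto
      also have "\<dots> \<le> 4 * qa Q * int n"
        unfolding xy[symmetric] four_a_qeval by simp
      finally show False using n by simp
    qed
    then have "y = 0 \<or> y = 1 \<or> y = -1" by linarith
    then show "p \<in> ?U" using xy unfolding p qeval_int by auto
  qed
  then have "rep_count Q n \<le> card ?U" unfolding rep_count_def
    by (rule card_mono[rotated]) (intro finite_UnI finite_imageI R)
  also have "\<dots> \<le> card (?R 0 (int n)) + (card (?R (qb Q) (int n - qc Q)) + card (?R (- qb Q) (int n - qc Q)))"
    by (intro order_trans[OF card_Un_le] add_mono card_image_le R)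
  also have "\<dots> \<le> 6" using R(2)[of 0 "int n"] R(2)[of "qb Q" "int n - qc Q"] R(2)[of "- qb Q" "int n - qc Q"] by linarith
  finally show ?thesis .
qed

text \<open>\<open>Q1\<close> is the form that comes first in the lexicographic order of
  (\<open>qa\<close>, \<open>qc\<close>). Below \<open>N\<close> both counts come from multiples of
  (1, 0) and agree; at \<open>N\<close> the form \<open>Q1\<close> gains (1, 0) or (0, 1)
  respectively, while \<open>Q2\<close> gains nothing. The bounds at \<open>Suc N\<close> limit the
  next coefficient.\<close>

lemma rep_count_first_difference:
  assumes Q1: "reduced_form Q1" "discriminant Q1 = - int D"
    and Q2: "reduced_form Q2" "discriminant Q2 = - int D" and D: "D > 0"
    and N: "qa Q1 < qa Q2 \<and> int N = qa Q1 \<or> qa Q1 = qa Q2 \<and> qc Q1 < qc Q2 \<and> int N = qc Q1"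
  shows "\<And>n. n < N \<Longrightarrow> rep_count Q1 n = rep_count Q2 n"
    and "rep_count Q1 N > rep_count Q2 N"
    and "rep_count Q1 (Suc N) \<le> 6" "rep_count Q2 (Suc N) \<le> 6"
proof -
  have d: "discriminant Q1 < 0" "discriminant Q2 < 0" using Q1 Q2 D by auto
  note a = reduced_qa_pos[OF Q1(1) d(1)] reduced_qa_pos[OF Q2(1) d(2)]
  have c: "qa Q1 \<le> qc Q1" "qa Q2 \<le> qc Q2" using Q1 Q2 by (auto simp: reduced_form_def)
  note below1 = rep_count_below_qc[OF Q1(1) d(1)] and below2 = rep_count_below_qc[OF Q2(1) d(2)]
  have small: "card {x. a * x\<^sup>2 = int n} = (if n = 0 then 1 else 0)" if "int n < a" for n a
  proof -
    have "{x. a * x\<^sup>2 = int n} = (if n = 0 then {0} else {})"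
    proof (cases "n = 0")
      case True
      then show ?thesis using that by auto
    next
      case False
      have "a * x\<^sup>2 \<noteq> int n" for x
      proof
        assume *: "a * x\<^sup>2 = int n"
        then have "a dvd int n" by (metis dvd_triv_left)
        then show False using False that zdvd_imp_le[of a "int n"] by simp
      qed
      then show ?thesis using False by auto
    qed
    then show ?thesis by simp
  qed
  show "rep_count Q1 n = rep_count Q2 n" if "n < N" for n
    using N
  proof
    assume "qa Q1 < qa Q2 \<and> int N = qa Q1"
    then have "int n < qa Q1" "int n < qa Q2" using that by auto
    then show ?thesis using below1[of n] below2[of n] c by (simp add: small)
  next
    assume "qa Q1 = qa Q2 \<and> qc Q1 < qc Q2 \<and> int N = qc Q1"
    then show ?thesis using below1[of n] below2[of n] that by simp
  qed
  show "rep_count Q1 N > rep_count Q2 N"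
    using N
  proof
    assume *: "qa Q1 < qa Q2 \<and> int N = qa Q1"
    then have "rep_count Q2 N = 0" using below2[of N] small[of N "qa Q2"] c a by auto
    moreover have "(1, 0) \<in> {(x::int, y). qeval Q1 x y = int N}" using * by (simp add: qeval_int)
    then have "rep_count Q1 N > 0" unfolding rep_count_def
      using finite_representations[OF a(1) d(1), of "int N"] card_gt_0_iff by blast
    ultimately show ?thesis by simp
  next
    assume "qa Q1 = qa Q2 \<and> qc Q1 < qc Q2 \<and> int N = qc Q1"
    then show ?thesis using rep_count_at_qc[OF Q1(1) d(1), of N] below2[of N] by simp
  qed
  \<comment> \<open>Writing a1 and a2 for the leading coefficients: in the first case N + 1 <= a2,
    so both products are at most a2^2 <= D/3; in the second they equal a1 c + a1 <= 2 a1 c <= 2D/3,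
    with c the last coefficient of \<open>Q1\<close>. This is what \<open>rep_count_le_6\<close>
    asks for.\<close>
  have bnd: "qa Q1 * (int N + 1) < int D \<and> qa Q2 * (int N + 1) < int D"
    using N
  proof
    assume *: "qa Q1 < qa Q2 \<and> int N = qa Q1"
    have "3 * (qa Q2 * qa Q2) \<le> int D" using reduced_disc_bound(1)[OF Q2(1) d(2)] Q2 by (simp add: power2_eq_square)
    moreover have "qa Q2 * (int N + 1) \<le> qa Q2 * qa Q2" using * a by (intro mult_left_mono) auto
    moreover have "qa Q1 * (int N + 1) \<le> qa Q2 * (int N + 1)" using * a by (intro mult_right_mono) auto
    moreover have "0 < qa Q2 * qa Q2" using a by simp
    ultimately show ?thesis by linarith
  next
    assume *: "qa Q1 = qa Q2 \<and> qc Q1 < qc Q2 \<and> int N = qc Q1"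
    have "3 * (qa Q1 * qc Q1) \<le> int D" using reduced_disc_bound(2)[OF Q1(1) d(1)] Q1 by simp
    moreover have "qa Q1 * 1 \<le> qa Q1 * qc Q1" using a c by (intro mult_left_mono) auto
    moreover have "qa Q1 * (int N + 1) = qa Q1 * qc Q1 + qa Q1" using * by (simp add: algebra_simps)
    ultimately have "qa Q1 * (int N + 1) < int D" using a by linarith
    then show ?thesis using * by simp
  qed
  show "rep_count Q1 (Suc N) \<le> 6" "rep_count Q2 (Suc N) \<le> 6"
    using bnd Q1 Q2 by (intro rep_count_le_6 a d; simp add: algebra_simps)+
qed

section \<open>Comparing q-expansions\<close>

text \<open>On the positive imaginary axis, where q = x lies in (0, 1), the eta quotient is x^h G(x)
  and the series is x^N g(x), with G and g nonzero at 0. Letting x tend to 0 forces h = N, and then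
  G - g and its derivative vanish at 0.\<close>

lemma leading_coefficients:
  fixes c :: "nat \<Rightarrow> complex" and a b :: int
  assumes sums: "\<And>z. Im z > 0 \<Longrightarrow>
      (\<lambda>n. c n * nome z ^ n) sums (dedekind_eta z powi a * dedekind_eta (of_nat D * z) powi b)"
    and below: "\<And>n. n < N \<Longrightarrow> c n = 0" and nz: "c N \<noteq> 0" and D: "D \<ge> 2"
  shows "24 * int N = a + b * int D" "c N = 1" "c (Suc N) = - of_int a"
proof -
  \<comment> \<open>\<open>h\<close> collects the exponents a/24 and bD/24 of the prefactors,
    \<open>G\<close> is the remaining quotient of Euler products, and \<open>g\<close> is the series
    divided by q^N.\<close>
  define h where "h = (real_of_int a + real_of_int b * real D) / 24"
  define G where "G = (\<lambda>q. euler_phi q powi a * euler_phi (q ^ D) powi b)"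
  define g where "g = (\<lambda>q::complex. \<Sum>n. c (n + N) * q ^ n)"
  have sums_x: "(\<lambda>n. c n * of_real x ^ n) sums (of_real (x powr h) * G (of_real x))"
    if x: "0 < x" "x < 1" for x :: real
  proof -
    \<comment> \<open>Chosen so that \<open>nome z\<close> is \<open>x\<close>; on this axis the
      fractional power q^h is the real power \<open>x powr h\<close>.\<close>
    define z where "z = \<i> * of_real (- ln x / (2 * pi))"
    have Im: "Im z > 0" using x by (simp add: z_def divide_neg_pos)
    have arg: "2 * of_real pi * \<i> * z = of_real (ln x)"
      unfolding z_def by (simp add: field_simps)
    have nome: "nome z = of_real x"
      unfolding nome_def arg using x by (simp only: exp_of_real) simp
    have 1: "exp (2 * of_real pi * \<i> * z / 24) = of_real (exp (ln x / 24))"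
      unfolding arg by (simp add: exp_of_real[symmetric])
    have "2 * of_real pi * \<i> * (of_nat D * z) / 24 = of_real (real D * ln x / 24)"
      using arg by (simp add: algebra_simps)
    then have 2: "exp (2 * of_real pi * \<i> * (of_nat D * z) / 24) = of_real (exp (real D * ln x / 24))"
      by (simp only: exp_of_real)
    have "dedekind_eta z powi a * dedekind_eta (of_nat D * z) powi b =
        (of_real (exp (ln x / 24)) powi a * of_real (exp (real D * ln x / 24)) powi b) * G (of_real x)"
      unfolding dedekind_eta_altdef 1 2 nome nome_of_nat_mult G_def
      by (simp add: power_int_mult_distrib)
    also have "of_real (exp (ln x / 24)) powi a * of_real (exp (real D * ln x / 24)) powi b =
        complex_of_real (exp (ln x / 24) powi a * exp (real D * ln x / 24) powi b)"
      by (simp only: of_real_mult of_real_power_int)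
    also have "exp (ln x / 24) powi a * exp (real D * ln x / 24) powi b = exp (h * ln x)"
      by (simp add: exp_power_int exp_add[symmetric] h_def field_simps)
    also have "exp (h * ln x) = x powr h" using x by (simp add: powr_def)
    finally show ?thesis using sums[OF Im] by (simp only: nome)
  qed
  have shift: "of_real (x powr h) * G (of_real x) = of_real x ^ N * g (of_real x) \<and>
      summable (\<lambda>n. c (n + N) * of_real x ^ n)"
    if x: "0 < x" "x < 1" for x :: real
  proof -
    have "(\<lambda>n. c (n + N) * of_real x ^ (n + N)) sums (of_real (x powr h) * G (of_real x))"
      using sums_iff_shift[of "\<lambda>n. c n * of_real x ^ n" N] sums_x[OF x] below by simp
    then have *: "(\<lambda>n. of_real x ^ N * (c (n + N) * of_real x ^ n)) sums (of_real (x powr h) * G (of_real x))"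
      by (simp add: power_add mult_ac)
    then have "summable (\<lambda>n. of_real x ^ N * (c (n + N) * of_real x ^ n))" by (rule sums_summable)
    then have s: "summable (\<lambda>n. c (n + N) * of_real x ^ n)"
      using x by (subst (asm) summable_cmult_iff) auto
    from * have "of_real (x powr h) * G (of_real x) = (\<Sum>n. of_real x ^ N * (c (n + N) * of_real x ^ n))"
      by (rule sums_unique)
    also have "\<dots> = of_real x ^ N * g (of_real x)" unfolding g_def by (rule suminf_mult[OF s])
    finally show ?thesis using s by blast
  qed
  have g_eq: "g (of_real x) = of_real (x powr (h - real N)) * G (of_real x)" if x: "0 < x" "x < 1" for x :: real
  proof -
    have "x powr h = x ^ N * x powr (h - real N)"
      using x by (simp add: powr_realpow[symmetric] powr_add[symmetric])
    then have "of_real x ^ N * g (of_real x) = of_real x ^ N * (of_real (x powr (h - real N)) * G (of_real x))"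
      using conjunct1[OF shift[OF x], symmetric] by (simp add: mult.assoc)
    then show ?thesis using x by simp
  qed
  have D0: "(0::complex) ^ D = 0" using D by simp
  \<comment> \<open>As \<open>D\<close> is at least 2, the map q to q^D has derivative 0 at 0, so
    eta(Dz) contributes nothing to the linear coefficient and only the exponent \<open>a\<close> is
    seen.\<close>
  have G_deriv: "(G has_field_derivative - of_int a) (at 0)"
  proof -
    have "((\<lambda>q. q ^ D) has_field_derivative 0) (at (0::complex))"
      by (rule derivative_eq_intros refl)+ (use D in auto)
    then have "((\<lambda>q. euler_phi (q ^ D)) has_field_derivative (-1) * 0) (at 0)"
      by (intro DERIV_chain2[where f = euler_phi]) (simp_all only: D0 euler_phi_deriv_0)
    then show ?thesis unfolding G_def
      by (auto intro!: derivative_eq_intros euler_phi_deriv_0 simp: D0)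
  qed
  have g_deriv: "(g has_field_derivative c (Suc N)) (at 0)"
  proof -
    have "summable (\<lambda>n. c (n + N) * complex_of_real (1/2) ^ n)"
      using shift[of "1/2"] by simp
    then have "((\<lambda>x. \<Sum>n. c (n + N) * x ^ n) has_field_derivative
        (\<Sum>n. diffs (\<lambda>n. c (n + N)) n * 0 ^ n)) (at 0)"
      by (rule termdiffs_strong) simp
    also have "(\<Sum>n. diffs (\<lambda>n. c (n + N)) n * 0 ^ n) = c (Suc N)"
      by (simp add: powser_zero diffs_def)
    finally show ?thesis by (simp add: g_def)
  qed
  have G0: "G 0 = 1" by (simp add: G_def D0)
  have g0: "g 0 = c N" by (simp add: g_def powser_zero)
  \<comment> \<open>The shift by 2 keeps every \<open>X k\<close>, including \<open>X 0\<close>,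
    strictly between 0 and 1.\<close>
  define X where "X = (\<lambda>k::nat. 1 / (real k + 2))"
  have X: "0 < X k" "X k < 1" for k by (auto simp: X_def)
  have X_lim: "X \<longlonglongrightarrow> 0" unfolding X_def by real_asymp
  then have "(\<lambda>k. complex_of_real (X k)) \<longlonglongrightarrow> of_real 0" by (rule tendsto_of_real)
  then have XC: "filterlim (\<lambda>k. complex_of_real (X k)) (at 0) sequentially"
    using X(1) by (intro filterlim_atI) (auto simp: less_imp_neq[symmetric] intro!: always_eventually)
  have lim0: "(\<lambda>k. f (complex_of_real (X k))) \<longlonglongrightarrow> f 0" if "(f has_field_derivative d) (at 0)"
    for f :: "complex \<Rightarrow> complex" and d
    using DERIV_isCont[OF that] XC unfolding isCont_def by (rule filterlim_compose)
  have G_lim: "(\<lambda>k. norm (G (of_real (X k)))) \<longlonglongrightarrow> 1"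
    using tendsto_norm[OF lim0[OF G_deriv]] by (simp add: G0)
  have g_lim: "(\<lambda>k. norm (g (of_real (X k)))) \<longlonglongrightarrow> norm (c N)"
    using tendsto_norm[OF lim0[OF g_deriv]] by (simp add: g0)
  have powr_lim: "(\<lambda>k. X k powr e) \<longlonglongrightarrow> 0" if "e > 0" for e
    using tendsto_powr'[OF X_lim tendsto_const, of e] that X(1) by (auto simp: less_imp_le)
  have norm_eq: "norm (g (of_real (X k))) = X k powr (h - real N) * norm (G (of_real (X k)))" for k
    using g_eq[OF X] by (simp add: norm_mult)
  \<comment> \<open>If h > N, then g tends to 0, against \<open>c N\<close> being nonzero; if h < N,
    then G tends to 0, against G(0) = 1.\<close>
  have "h = real N"
  proof (rule linorder_cases[of h "real N"])
    assume "h > real N"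
    then have "(\<lambda>k. norm (g (of_real (X k)))) \<longlonglongrightarrow> 0 * 1"
      unfolding norm_eq by (intro tendsto_mult powr_lim G_lim) auto
    then have "norm (c N) = 0" using g_lim LIMSEQ_unique by fastforce
    then show ?thesis using nz by simp
  next
    assume less: "h < real N"
    have "norm (G (of_real (X k))) = X k powr (real N - h) * norm (g (of_real (X k)))" for k
      unfolding norm_eq using X(1)[of k] by (simp add: powr_add[symmetric] flip: mult.assoc)
    then have "(\<lambda>k. norm (G (of_real (X k)))) \<longlonglongrightarrow> 0 * norm (c N)"
      using less by (simp only:) (intro tendsto_mult powr_lim g_lim; simp)
    then have "(1::real) = 0" using G_lim LIMSEQ_unique by fastforce
    then show ?thesis by simp
  qed
  then have "real_of_int (24 * int N) = real_of_int (a + b * int D)" by (simp add: h_def)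
  then show "24 * int N = a + b * int D" by linarith
  \<comment> \<open>\<open>H\<close> vanishes along a sequence tending to 0, so continuity gives
    H(0) = 0 and the difference quotients give H'(0) = 0.\<close>
  define H where "H = (\<lambda>q. G q - g q)"
  have H_zero: "H (of_real (X k)) = 0" for k
    using g_eq[OF X, of k] X(1)[of k] by (simp add: H_def \<open>h = real N\<close>)
  have H_deriv: "(H has_field_derivative (- of_int a - c (Suc N))) (at 0)"
    unfolding H_def by (intro DERIV_diff G_deriv g_deriv)
  have "H 0 = 0"
    using lim0[OF H_deriv] by (simp add: H_zero LIMSEQ_const_iff)
  then show "c N = 1" by (simp add: H_def G0 g0)
  have "((\<lambda>x. (H (0 + x) - H 0) / x) \<longlongrightarrow> - of_int a - c (Suc N)) (at 0)"
    using H_deriv by (simp add: DERIV_def)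
  then have "(\<lambda>k. (H (0 + of_real (X k)) - H 0) / of_real (X k)) \<longlonglongrightarrow> - of_int a - c (Suc N)"
    using XC by (rule filterlim_compose)
  then have "- of_int a - c (Suc N) = 0"
    by (simp add: H_zero \<open>H 0 = 0\<close> LIMSEQ_const_iff)
  then show "c (Suc N) = - of_int a" by (simp add: algebra_simps)
qed

section \<open>Arithmetic constraints on the exponents\<close>

text \<open>Case of different leading coefficients: \<open>A\<close> is the smaller one, and the
  bound on \<open>A + 1\<close> is inherited from the larger. It makes D at least quadratic in A, so
  that 24A = a + bD allows only b = 1 and b = 2; congruences modulo 4 and 3 then settle a.\<close>

lemma exponents_unequal_leading:
  fixes A D a b :: int
  assumes D: "D mod 4 = 3" "\<not> 3 dvd D" and A: "A \<ge> 1" "3 * (A + 1)\<^sup>2 \<le> D"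
    and h: "24 * A = a + b * D" and a: "\<bar>a\<bar> \<le> 3"
  shows "a = 1 \<and> b = 1"
proof -
  have D_pos: "D > 0" using A by (smt (verit) zero_le_power2 zero_less_power2)
  have b1: "b \<ge> 1"
  proof (rule ccontr)
    assume "\<not> b \<ge> 1"
    then have "b * D \<le> 0" using D_pos by (simp add: mult_nonpos_nonneg)
    then show False using h a A by linarith
  qed
  \<comment> \<open>Otherwise 9 (A + 1)^2 <= 3D <= 24A + 3, but the left side is (3A - 1)^2 + 24A +
    8.\<close>
  have "b < 3"
  proof (rule ccontr)
    assume "\<not> b < 3"
    then have "3 * D \<le> b * D" using D_pos by (intro mult_right_mono) auto
    then have "9 * (A + 1)\<^sup>2 \<le> 24 * A + 3" using h a A by linarith
    moreover have "9 * (A + 1)\<^sup>2 = (3 * A - 1)\<^sup>2 + 24 * A + 8" by (simp add: power2_eq_square algebra_simps)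
    ultimately show False by (smt (verit) zero_le_power2)
  qed
  with b1 consider "b = 1" | "b = 2" by linarith
  then show ?thesis
  proof cases
    case 1
    then have "D = 24 * A - a" using h by simp
    \<comment> \<open>The residue modulo 4 leaves a = -3 and a = 1, and -3 would make D a multiple
      of 3.\<close>
    then have "a mod 4 = 1" "\<not> 3 dvd a" using D by presburger+
    moreover have "- 3 \<le> a" "a \<le> 3" using a by auto
    ultimately have "a = 1" by presburger
    then show ?thesis using 1 by simp
  next
    case 2
    \<comment> \<open>Here a/2 = 12A - D is 1 modulo 4, which forces a = 2; but then D = 12A - 1 is
      below 3 (A + 1)^2.\<close>
    have "a \<noteq> 2"
    proof
      assume "a = 2"
      then have "D = 12 * A - 1" using h 2 by simp
      then have "3 * (A + 1)\<^sup>2 \<le> 12 * A - 1" using A by simp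
      moreover have "3 * (A + 1)\<^sup>2 = 3 * (A - 1)\<^sup>2 + 12 * A" by (simp add: power2_eq_square algebra_simps)
      ultimately show False by (smt (verit) zero_le_power2)
    qed
    moreover have "a = 2"
    proof -
      define a' where "a' = 12 * A - D"
      have a': "a = 2 * a'" using h 2 by (simp add: a'_def)
      then have "- 1 \<le> a'" "a' \<le> 1" using a by linarith+
      moreover have "a' mod 4 = 1" using D(1) unfolding a'_def by presburger
      ultimately have "a' = 1" by presburger
      then show ?thesis using a' by simp
    qed
    ultimately show ?thesis by simp
  qed
qed

text \<open>Case of a common leading coefficient \<open>A\<close>, with middle coefficients
  \<open>B\<close> and \<open>B'\<close>. Eliminating C gives D (bA - 6) = 6B^2 - aA. The right side
  lies strictly between -D and 2D, so bA is 6 or 7 and few values of A remain.\<close>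

lemma exponents_equal_leading:
  fixes A B B' C C' D a b :: int
  assumes D: "D mod 4 = 3" "\<not> 3 dvd D" and A: "3 * A\<^sup>2 \<le> D"
    and B: "odd B" "odd B'" "\<bar>B\<bar> < \<bar>B'\<bar>" "\<bar>B'\<bar> \<le> A"
    and disc: "D = 4 * A * C - B\<^sup>2" "D = 4 * A * C' - B'\<^sup>2"
    and h: "24 * C = a + b * D" and a: "\<bar>a\<bar> \<le> 3"
  shows "a = 1 \<and> b = 1 \<and> A = 6 \<and> \<bar>B\<bar> = 1 \<and> \<bar>B'\<bar> = 5"
proof -
  \<comment> \<open>Two different odd absolute values are at least 2 apart; the resulting |B| <= A -
    2 is what keeps 6B^2 - aA below 2D.\<close>
  have "\<bar>B\<bar> + 2 \<le> \<bar>B'\<bar>" using B by presburger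
  then have BA: "\<bar>B\<bar> \<le> A - 2" using B by linarith
  have A3: "A \<ge> 3"
  proof -
    have "\<bar>B\<bar> \<ge> 1" using B(1) by (cases "B = 0") auto
    then show ?thesis using BA by linarith
  qed
  have AA: "3 * (A * A) \<le> D" using A by (simp add: power2_eq_square)
  have AA3: "3 * A \<le> A * A" using A3 by (intro mult_right_mono) auto
  have D_nonneg: "D \<ge> 0" using AA AA3 A3 by linarith
  have B_sq: "B\<^sup>2 \<le> (A - 2)\<^sup>2" using BA A3 by (intro power2_le_iff_abs_le[THEN iffD2]) auto
  have B_sq': "(A - 2)\<^sup>2 = A * A - 4 * A + 4" by (simp add: power2_eq_square algebra_simps)
  have B_sq1: "1 \<le> B\<^sup>2" using B(1) by (metis dvd_0_right int_one_le_iff_zero_less zero_less_power2)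
  have aA: "\<bar>a * A\<bar> \<le> 3 * A" unfolding abs_mult using a A3 by (intro mult_mono) auto
  define t where "t = b * A - 6"
  have main: "D * t = 6 * B\<^sup>2 - a * A"
  proof -
    have "6 * (D + B\<^sup>2) = A * (24 * C)" using disc(1) by simp
    then show ?thesis unfolding h t_def by (simp add: algebra_simps)
  qed
  have "t < 2"
  proof (rule ccontr)
    assume "\<not> t < 2"
    then have "D * 2 \<le> D * t" using D_nonneg by (intro mult_left_mono) auto
    then show False using main B_sq B_sq' aA AA A3 by linarith
  qed
  moreover have "t > -1"
  proof (rule ccontr)
    assume "\<not> t > -1"
    then have "D * t \<le> D * (-1)" using D_nonneg by (intro mult_left_mono) auto
    then show False using main B_sq1 aA AA AA3 A3 by linarith
  qed
  ultimately consider "b * A = 6" | "b * A = 7" unfolding t_def by linarith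
  then show ?thesis
  proof cases
    case 1
    then have b: "b = 1 \<and> A = 6 \<or> b = 2 \<and> A = 3"
    proof -
      have "A dvd 6" using 1 by (metis dvd_triv_right)
      then have "A \<le> 6" using zdvd_imp_le by fastforce
      then have "A = 3 \<or> A = 4 \<or> A = 5 \<or> A = 6" using A3 by linarith
      then show ?thesis using 1 by (elim disjE; simp; presburger)
    qed
    then show ?thesis
    proof
      \<comment> \<open>Now the identity says a = B^2, so |a| <= 3 gives |B| = 1. Then |B'| is 3 or
        5, and 3 would make D a multiple of 3.\<close>
      assume A6: "b = 1 \<and> A = 6"
      have "a = B\<^sup>2" using main A6 by (simp add: t_def)
      have "\<bar>B\<bar> \<noteq> 3"
      proof
        assume "\<bar>B\<bar> = 3"
        then have "a = 3\<^sup>2" using \<open>a = B\<^sup>2\<close> by (metis power2_abs)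
        then show False using a by simp
      qed
      moreover have "\<bar>B\<bar> \<le> 4" using BA A6 by linarith
      ultimately have B1: "\<bar>B\<bar> = 1" using B(1) by presburger
      then have "a = 1" using \<open>a = B\<^sup>2\<close> by (metis one_power2 power2_abs)
      have "\<bar>B'\<bar> \<noteq> 3"
      proof
        assume "\<bar>B'\<bar> = 3"
        then have "B'\<^sup>2 = 9" by (simp flip: power2_abs[of B'])
        then have "D = 3 * (8 * C' - 3)" using disc(2) A6 by simp
        then show False using D(2) by (metis dvd_triv_left)
      qed
      then have "\<bar>B'\<bar> = 5" using B B1 A6 by presburger
      then show ?thesis using \<open>a = 1\<close> B1 A6 by simp
    next
      assume A3: "b = 2 \<and> A = 3"
      then have "\<bar>B'\<bar> = 3" using B BA by presburger
      then have "B'\<^sup>2 = 9" by (simp flip: power2_abs[of B'])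
      then have "D = 3 * (4 * C' - 3)" using disc(2) A3 by simp
      then show ?thesis using D(2) by (metis dvd_triv_left)
    qed
  next
    case 2
    have "A = 7 \<and> b = 1"
    proof -
      have "A dvd 7" using 2 by (metis dvd_triv_right)
      then have "A \<le> 7" using zdvd_imp_le by fastforce
      then have "A = 3 \<or> A = 4 \<or> A = 5 \<or> A = 6 \<or> A = 7" using A3 by linarith
      then show ?thesis using 2 by (elim disjE; simp; presburger)
    qed
    then have A7: "A = 7" "b = 1" by auto
    then have "D = 24 * C - a" using h by simp
    then have "a mod 4 = 1" "\<not> 3 dvd a" using D by presburger+
    moreover have "- 3 \<le> a" "a \<le> 3" using a by auto
    ultimately have "a = 1" by presburger
    \<comment> \<open>Here D = 6B^2 - 7 with |B| <= 5, while 3A^2 = 147 should be at most D.\<close>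
    then have "D \<le> 143" using main B_sq A7 by (simp add: t_def)
    then show ?thesis using AA A7 by simp
  qed
qed

section \<open>Classification of the eta quotients of prime level\<close>

lemma euler_phi_nonzero: "norm q < 1 \<Longrightarrow> euler_phi q \<noteq> 0"
  unfolding euler_phi_def
proof (rule prodinf_nonzero[OF euler_phi_convergent])
  fix n assume "norm q < 1"
  then have "norm (q ^ Suc n) < 1" unfolding norm_power by (subst power_less_one_iff) auto
  then show "1 - q ^ Suc n \<noteq> 0" by (metis eq_iff_diff_eq_0 less_irrefl norm_one)
qed

text \<open>Serves to exclude two forms with equal theta functions, whose half difference is
  zero.\<close>

lemma dedekind_eta_nonzero: "Im z > 0 \<Longrightarrow> dedekind_eta z \<noteq> 0"
  using euler_phi_nonzero[OF norm_nome_less_1] by (simp add: dedekind_eta_altdef)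

text \<open>In D = 4ac - b^2 an even b would make 4 divide the prime D, and an odd b has b^2 = 1
  modulo 4.\<close>

lemma prime_disc:
  fixes Q :: qform
  assumes "prime D" "discriminant Q = - int D"
  shows "odd (qb Q)" "int D mod 4 = 3"
proof -
  have D: "int D = 4 * (qa Q * qc Q) - (qb Q)\<^sup>2" using assms(2) by (simp add: discriminant_def)
  show odd: "odd (qb Q)"
  proof
    assume "even (qb Q)"
    then obtain m where "qb Q = 2 * m" by blast
    then have "int D = int 4 * (qa Q * qc Q - m\<^sup>2)" using D by (simp add: power2_eq_square algebra_simps)
    then have "4 dvd D" by (metis dvd_triv_left int_dvd_int_iff)
    then have "4 = D" using assms(1) by (metis One_nat_def numeral_eq_one_iff prime_nat_iff semiring_norm(85))
    then have "prime (2 * 2 :: nat)" using assms(1) by simp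
    then show False using prime_product by fastforce
  qed
  then obtain m where "qb Q = 2 * m + 1" by (rule oddE)
  then have "int D = 4 * (qa Q * qc Q - m\<^sup>2 - m - 1) + 3" using D by (simp add: power2_eq_square algebra_simps)
  then show "int D mod 4 = 3" by presburger
qed

text \<open>The pairs (\<open>qa\<close>, \<open>qc\<close>) of the two forms are compared
  lexicographically. The first nonzero coefficient equals 1, so \<open>Qs\<close> has the larger
  count there and must be the smaller form. The next coefficient is -a and half a difference of two
  numbers in [0, 6], so |a| <= 3. If the pairs agree, the forms are equal or conjugate and the
  difference is zero.\<close>

lemma eta_quotient_eq_half_theta_diffD:
  fixes a b :: int
  assumes D: "prime D"
    and Qs: "reduced_form Qs" "discriminant Qs = - int D"
    and Qr: "reduced_form Qr" "discriminant Qr = - int D"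
    and eq: "\<And>z. Im z > 0 \<Longrightarrow>
      dedekind_eta z powi a * dedekind_eta (of_nat D * z) powi b = half_theta_diff Qs Qr z"
  shows "a = 1 \<and> b = 1 \<and> D mod 24 = 23 \<and>
    (qa Qs < qa Qr \<and> 24 * qa Qs = int D + 1 \<or>
     qa Qs = 6 \<and> qa Qr = 6 \<and> \<bar>qb Qs\<bar> = 1 \<and> \<bar>qb Qr\<bar> = 5)"
proof -
  have D0: "D > 0" "D \<ge> 2" using D prime_gt_0_nat prime_ge_2_nat by auto
  have neg: "discriminant Qs < 0" "discriminant Qr < 0" using Qs Qr D0 by auto
  note pos = reduced_qa_pos[OF Qs(1) neg(1)] reduced_qa_pos[OF Qr(1) neg(2)]
  note D4 = prime_disc[OF D Qs(2)] prime_disc[OF D Qr(2)]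
  define c where "c = (\<lambda>n. (of_nat (rep_count Qs n) - of_nat (rep_count Qr n)) / 2 :: complex)"
  have sums: "(\<lambda>n. c n * nome z ^ n) sums (dedekind_eta z powi a * dedekind_eta (of_nat D * z) powi b)"
    if z: "Im z > 0" for z
  proof -
    have "(\<lambda>n. (of_nat (rep_count Qs n) * nome z ^ n - of_nat (rep_count Qr n) * nome z ^ n) / 2) sums half_theta_diff Qs Qr z"
      unfolding half_theta_diff_def by (intro sums_divide sums_diff form_theta_sums pos neg z)
    then show ?thesis unfolding eq[OF z] by (simp add: c_def algebra_simps diff_divide_distrib)
  qed
  have lead: "24 * int N = a + b * int D" "rep_count Qs N > rep_count Qr N" "\<bar>a\<bar> \<le> 3"
    if "\<And>n. n < N \<Longrightarrow> rep_count Qs n = rep_count Qr n" "rep_count Qs N \<noteq> rep_count Qr N"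
      "rep_count Qs (Suc N) \<le> 6" "rep_count Qr (Suc N) \<le> 6" for N
  proof -
    have *: "24 * int N = a + b * int D" "c N = 1" "c (Suc N) = - of_int a"
      by (rule leading_coefficients[OF sums, of N]; use that D0 in \<open>simp add: c_def\<close>)+
    show "24 * int N = a + b * int D" by fact
    have "complex_of_int (int (rep_count Qs N) - int (rep_count Qr N)) = of_int 2"
      using *(2) by (simp add: c_def)
    then show "rep_count Qs N > rep_count Qr N" unfolding of_int_eq_iff by linarith
    have "complex_of_int (int (rep_count Qs (Suc N)) - int (rep_count Qr (Suc N))) = of_int (- 2 * a)"
      using *(3) by (simp add: c_def field_simps)
    then show "\<bar>a\<bar> \<le> 3" unfolding of_int_eq_iff using that by linarith
  qed
  \<comment> \<open>The guard sets aside D = 3, a prime divisible by 3; in both uses a leading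
    coefficient of at least 2 gives D >= 12.\<close>
  have not3: "\<not> 3 dvd int D" if "int D > 3"
  proof
    assume "3 dvd int D"
    then have "3 dvd D" by presburger
    then have "3 = D" using D by (metis One_nat_def numeral_eq_one_iff prime_nat_iff semiring_norm(86))
    then show False using that by simp
  qed
  have D24: "D mod 24 = 23" if "24 * N = int D + 1" for N
    using that by presburger
  have bound: "3 * (qa Qs)\<^sup>2 \<le> int D" "3 * (qa Qr)\<^sup>2 \<le> int D"
    using reduced_disc_bound(1)[OF Qs(1) neg(1)] reduced_disc_bound(1)[OF Qr(1) neg(2)] Qs Qr by auto
  consider "qa Qs < qa Qr" | "qa Qr < qa Qs" | "qa Qs = qa Qr" "qc Qs < qc Qr" | "qa Qs = qa Qr" "qc Qr < qc Qs"
    | "qa Qs = qa Qr" "qc Qs = qc Qr" by linarith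
  then show ?thesis
  proof cases
    case 1
    define N where "N = nat (qa Qs)"
    have N: "qa Qs < qa Qr \<and> int N = qa Qs \<or> qa Qs = qa Qr \<and> qc Qs < qc Qr \<and> int N = qc Qs"
      using 1 pos by (simp add: N_def)
    note r = rep_count_first_difference[OF Qs Qr D0(1) N]
    have l: "24 * int N = a + b * int D" "\<bar>a\<bar> \<le> 3"
      by (rule lead; use r in simp)+
    have "3 * (qa Qs + 1)\<^sup>2 \<le> 3 * (qa Qr)\<^sup>2" using 1 pos by (intro mult_left_mono power_mono) auto
    then have A: "3 * (qa Qs + 1)\<^sup>2 \<le> int D" using bound by linarith
    moreover have "(1 + 1)\<^sup>2 \<le> (qa Qs + 1)\<^sup>2" using pos by (intro power_mono) auto
    ultimately have "int D > 3" by simp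
    note not3 = not3[OF this]
    have "int N = qa Qs" using N 1 by linarith
    then have l1: "24 * qa Qs = a + b * int D" using l(1) by simp
    have "1 \<le> qa Qs" using pos by simp
    then have ab: "a = 1 \<and> b = 1"
      by (rule exponents_unequal_leading[OF D4(2) not3 _ A l1 l(2)])
    then have "24 * qa Qs = int D + 1" using l1 by simp
    moreover from D24[OF this] have "D mod 24 = 23" .
    ultimately show ?thesis using 1 ab by simp
  next
    case 2
    define N where "N = nat (qa Qr)"
    have N: "qa Qr < qa Qs \<and> int N = qa Qr \<or> qa Qr = qa Qs \<and> qc Qr < qc Qs \<and> int N = qc Qr"
      using 2 pos by (simp add: N_def)
    note r = rep_count_first_difference[OF Qr Qs D0(1) N]
    have "rep_count Qs N > rep_count Qr N" by (rule lead; use r in simp)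
    then show ?thesis using r by simp
  next
    case 3
    define N where "N = nat (qc Qs)"
    have "qa Qs \<le> qc Qs" using Qs(1) by (simp add: reduced_form_def)
    then have N: "qa Qs < qa Qr \<and> int N = qa Qs \<or> qa Qs = qa Qr \<and> qc Qs < qc Qr \<and> int N = qc Qs"
      using 3 pos by (simp add: N_def)
    note r = rep_count_first_difference[OF Qs Qr D0(1) N]
    have l: "24 * int N = a + b * int D" "\<bar>a\<bar> \<le> 3"
      by (rule lead; use r in simp)+
    have disc: "int D = 4 * qa Qs * qc Qs - (qb Qs)\<^sup>2" "int D = 4 * qa Qs * qc Qr - (qb Qr)\<^sup>2"
      using Qs Qr 3 by (auto simp: discriminant_def)
    have "4 * qa Qs * qc Qs < 4 * qa Qs * qc Qr" using 3 pos by simp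
    then have "(qb Qs)\<^sup>2 < (qb Qr)\<^sup>2" using disc by linarith
    then have B: "\<bar>qb Qs\<bar> < \<bar>qb Qr\<bar>" by (metis abs_le_square_iff linorder_not_le)
    have B': "\<bar>qb Qr\<bar> \<le> qa Qs" using Qr(1) 3 by (simp add: reduced_form_def)
    then have "2\<^sup>2 \<le> (qa Qs)\<^sup>2" using B D4 by (intro power_mono) presburger+
    then have "int D > 3" using bound by simp
    note not3 = not3[OF this]
    have "int N = qc Qs" using N 3 by linarith
    then have l1: "24 * qc Qs = a + b * int D" using l(1) by simp
    have *: "a = 1 \<and> b = 1 \<and> qa Qs = 6 \<and> \<bar>qb Qs\<bar> = 1 \<and> \<bar>qb Qr\<bar> = 5"
      by (rule exponents_equal_leading[OF D4(2) not3 bound(1) D4(1,3) B B' disc l1 l(2)])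
    then have "24 * int N = int D + 1" using l(1) by simp
    from D24[OF this] show ?thesis using * 3 by simp
  next
    case 4
    define N where "N = nat (qc Qr)"
    have "qa Qr \<le> qc Qr" using Qr(1) by (simp add: reduced_form_def)
    then have N: "qa Qr < qa Qs \<and> int N = qa Qr \<or> qa Qr = qa Qs \<and> qc Qr < qc Qs \<and> int N = qc Qr"
      using 4 pos by (simp add: N_def)
    note r = rep_count_first_difference[OF Qr Qs D0(1) N]
    have "rep_count Qs N > rep_count Qr N" by (rule lead; use r in simp)
    then show ?thesis using r by simp
  next
    case 5
    then have "(qb Qs)\<^sup>2 = (qb Qr)\<^sup>2" using Qs(2) Qr(2) by (simp add: discriminant_def)
    then have "qb Qr = qb Qs \<or> qb Qr = - qb Qs" by (auto simp: power2_eq_iff)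
    then have "form_theta Qr z = form_theta Qs z" for z
      using 5 form_theta_flip_b[of "qa Qs" "qb Qs" "qc Qs" z] by (cases Qs; cases Qr) auto
    then have "dedekind_eta \<i> powi a * dedekind_eta (of_nat D * \<i>) powi b = 0"
      using eq[of \<i>] by (simp add: half_theta_diff_def)
    then show ?thesis using dedekind_eta_nonzero[of \<i>] dedekind_eta_nonzero[of "of_nat D * \<i>"] D0 by auto
  qed
qed

section \<open>Reduction and uniqueness\<close>

lemma properly_equivalent_trans:
  assumes "properly_equivalent Q1 Q2" "properly_equivalent Q2 Q3"
  shows "properly_equivalent Q1 Q3"
proof -
  obtain p q r s where 1: "p * s - q * r = 1" "\<And>x y :: int. qeval Q1 x y = qeval Q2 (p * x + q * y) (r * x + s * y)"
    using assms(1) unfolding properly_equivalent_def by blast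
  obtain p' q' r' s' where 2: "p' * s' - q' * r' = 1" "\<And>x y :: int. qeval Q2 x y = qeval Q3 (p' * x + q' * y) (r' * x + s' * y)"
    using assms(2) unfolding properly_equivalent_def by blast
  have "(p' * p + q' * r) * (r' * q + s' * s) - (p' * q + q' * s) * (r' * p + s' * r) =
      (p' * s' - q' * r') * (p * s - q * r)" by (simp add: algebra_simps)
  moreover have "qeval Q1 x y = qeval Q3 ((p' * p + q' * r) * x + (p' * q + q' * s) * y) ((r' * p + s' * r) * x + (r' * q + s' * s) * y)"
    for x y :: int unfolding 1(2) 2(2) by (simp add: algebra_simps)
  ultimately show ?thesis unfolding properly_equivalent_def 1(1) 2(1) by (metis mult_1)
qed

lemma properly_equivalentI:
  assumes "p * s - q * r = (1::int)"
    and "\<And>x y :: int. qeval Q1 x y = qeval Q2 (p * x + q * y) (r * x + s * y)"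
  shows "properly_equivalent Q1 Q2"
  using assms unfolding properly_equivalent_def by blast

text \<open>Gauss reduction: a translation brings b into (-a, a]; if then c < a, exchanging the
  outer coefficients lowers the leading one, which is the induction measure.\<close>

lemma exists_reduced_form:
  assumes "qa Q > 0" "discriminant Q < 0"
  shows "\<exists>R. properly_equivalent Q R \<and> reduced_form R \<and> discriminant R = discriminant Q"
  using assms
proof (induction "nat (qa Q)" arbitrary: Q rule: less_induct)
  case less
  obtain a b c where Q: "Q = QForm a b c" by (cases Q)
  have a: "a > 0" using less.prems Q by simp
  \<comment> \<open>Rounded so that \<open>b1\<close> is a minus a residue modulo 2a, hence -a < b1
    <= a; the strict lower bound already gives the sign condition for |b1| = a.\<close>
  define k where "k = (a - b) div (2 * a)"
  define b1 where "b1 = b + 2 * a * k"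
  define c1 where "c1 = a * k\<^sup>2 + b * k + c"
  have "a - b1 = (a - b) mod (2 * a)" unfolding b1_def k_def
    using mult_div_mod_eq[of "2 * a" "a - b"] by linarith
  moreover have "0 \<le> (a - b) mod (2 * a)" "(a - b) mod (2 * a) < 2 * a" using a by simp_all
  ultimately have b1: "- a < b1" "b1 \<le> a" by linarith+
  have equiv1: "properly_equivalent Q (QForm a b1 c1)"
    by (rule properly_equivalentI[of 1 1 "- k" 0])
      (simp_all add: Q qeval_def b1_def c1_def power2_eq_square algebra_simps)
  have disc1: "b1\<^sup>2 - 4 * a * c1 = discriminant Q"
    by (simp add: Q discriminant_def b1_def c1_def power2_eq_square algebra_simps)
  have equiv2: "properly_equivalent (QForm a b1 c1) (QForm c1 (- b1) a)"
    by (rule properly_equivalentI[of 0 0 1 "-1"])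
      (simp_all add: qeval_def power2_eq_square algebra_simps)
  consider "c1 < a" | "a = c1" "b1 < 0" | "a < c1 \<or> a = c1 \<and> b1 \<ge> 0" by linarith
  then show ?case
  proof cases
    case 1
    have "4 * a * c1 > 0" using disc1 less.prems zero_le_power2[of b1] by linarith
    then have "c1 > 0" using a by (simp add: zero_less_mult_iff)
    moreover have "discriminant (QForm c1 (- b1) a) = discriminant Q"
      using disc1 by (simp add: discriminant_def algebra_simps)
    ultimately obtain R where "properly_equivalent (QForm c1 (- b1) a) R" "reduced_form R" "discriminant R = discriminant Q"
      using less.hyps[of "QForm c1 (- b1) a"] 1 a less.prems Q by auto
    then show ?thesis using equiv1 equiv2 properly_equivalent_trans by blast
  next
    case 2
    \<comment> \<open>With equal outer coefficients the exchange only changes the sign of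
      \<open>b1\<close>, as the last condition of \<open>reduced_form\<close> requires.\<close>
    have "reduced_form (QForm c1 (- b1) a)" using 2 b1 by (auto simp: reduced_form_def)
    moreover have "discriminant (QForm c1 (- b1) a) = discriminant Q"
      using disc1 by (simp add: discriminant_def algebra_simps)
    ultimately show ?thesis using equiv1 equiv2 properly_equivalent_trans by blast
  next
    case 3
    have "reduced_form (QForm a b1 c1)" using 3 b1 by (auto simp: reduced_form_def)
    moreover have "discriminant (QForm a b1 c1) = discriminant Q"
      using disc1 by (simp add: discriminant_def)
    ultimately show ?thesis using equiv1 by blast
  qed
qed

section \<open>Schoeneberg pairs for prime D\<close>

text \<open>The values k = 4 and k = 5 belong to 95 = 5 * 19 and 119 = 7 * 17, so four shapes remain
  for prime D.\<close>

lemma schoeneberg_pair_cases: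
  assumes D: "prime D" "D mod 24 = 23" and k: "int D + 1 = 24 * k"
  obtains "k \<ge> 6" "schoeneberg_pair D = (QForm 6 1 k, QForm 6 5 (k + 1))"
  | "k = 1" "schoeneberg_pair D = (QForm 1 1 6, QForm 2 1 3)"
  | "k = 2" "schoeneberg_pair D = (QForm 2 1 6, QForm 3 1 4)"
  | "k = 3" "schoeneberg_pair D = (QForm 3 1 6, QForm 4 3 5)"
proof -
  have "k \<ge> 1" using k by linarith
  then obtain n where n: "k = int n" by (metis nonneg_int_cases order_trans zero_le_one)
  have "D + 1 = 24 * n" using k n by linarith
  moreover from this have "D + 25 = 24 * (n + 1)" by simp
  ultimately have k_div: "int ((D + 1) div 24) = k" "int ((D + 25) div 24) = k + 1" using n by simp_all
  have composite: "\<not> prime n" if "n = l * m" "l \<noteq> 1" "m \<noteq> 1" for l m n :: nat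
    using prime_product[of l m] that by auto
  have not_prime: "\<not> prime (95::nat)" "\<not> prime (119::nat)"
    by (rule composite[of 95 5 19] composite[of 119 7 17]; simp)+
  have "k \<noteq> 4" "k \<noteq> 5"
  proof -
    show "k \<noteq> 4"
    proof
      assume "k = 4"
      then have "D = 95" using k by linarith
      then show False using D not_prime by simp
    qed
    show "k \<noteq> 5"
    proof
      assume "k = 5"
      then have "D = 119" using k by linarith
      then show False using D not_prime by simp
    qed
  qed
  with \<open>k \<ge> 1\<close> consider "k \<ge> 6" | "k = 1" | "k = 2" | "k = 3" by linarith
  then show thesis
  proof cases
    case 1
    then have "(D + 1) div 24 \<ge> 6" using k_div by linarith
    then have "schoeneberg_pair D = (QForm 6 1 k, QForm 6 5 (k + 1))"
      unfolding schoeneberg_pair_def k_div[symmetric] by simp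
    then show thesis using that(1) 1 by blast
  next
    case 2
    then have "D = 23" using k by linarith
    then show thesis using that(2) 2 by (simp add: schoeneberg_pair_def)
  next
    case 3
    then have "D = 47" using k by linarith
    then show thesis using that(3) 3 by (simp add: schoeneberg_pair_def)
  next
    case 4
    then have "D = 71" using k by linarith
    then show thesis using that(4) 4 by (simp add: schoeneberg_pair_def)
  qed
qed

text \<open>Coprimality of the first two coefficients implies primitivity and holds for every
  Schoeneberg form that occurs here.\<close>

lemma forms_of_discI:
  assumes "coprime (qa Q) (qb Q)" "qa Q > 0" "discriminant Q = d" "d < 0"
  shows "Q \<in> forms_of_disc d"
proof -
  have "Gcd {qa Q, qb Q, qc Q} = gcd (gcd (qa Q) (qb Q)) (qc Q)" by (simp add: gcd.assoc)
  then have "primitive_form Q" using assms(1) by (simp add: primitive_form_def)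
  then show ?thesis using positive_definiteI assms by (simp add: forms_of_disc_def)
qed

lemma schoeneberg_pair_forms:
  assumes D: "prime D" "D mod 24 = 23" and pair: "schoeneberg_pair D = (Qs, Qr)"
  shows "Qs \<in> forms_of_disc (- int D)" "reduced_form Qs" "Qr \<in> forms_of_disc (- int D)" "reduced_form Qr" "Qs \<noteq> Qr"
proof -
  define k where "k = (int D + 1) div 24"
  have k: "int D + 1 = 24 * k" unfolding k_def using D(2) by presburger
  have D': "int D = 24 * k - 1" using k by simp
  have D0: "- int D < 0" using D(1) prime_gt_0_nat by simp
  have cop: "coprime (6::int) 5" "coprime (4::int) 3" by (simp_all add: coprime_iff_gcd_eq_1 gcd_non_0_int)
  have "Qs \<in> forms_of_disc (- int D) \<and> reduced_form Qs \<and> Qr \<in> forms_of_disc (- int D) \<and> reduced_form Qr \<and> Qs \<noteq> Qr"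
    using schoeneberg_pair_cases[OF D k]
  proof cases
    case 1
    then show ?thesis using pair D' D0 cop
      by (auto intro!: forms_of_discI simp: discriminant_def reduced_form_def)
  next
    case 2
    then show ?thesis using pair D' D0 cop
      by (auto intro!: forms_of_discI simp: discriminant_def reduced_form_def)
  next
    case 3
    then show ?thesis using pair D' D0 cop
      by (auto intro!: forms_of_discI simp: discriminant_def reduced_form_def)
  next
    case 4
    then show ?thesis using pair D' D0 cop
      by (auto intro!: forms_of_discI simp: discriminant_def reduced_form_def)
  qed
  then show "Qs \<in> forms_of_disc (- int D)" "reduced_form Qs" "Qr \<in> forms_of_disc (- int D)" "reduced_form Qr" "Qs \<noteq> Qr"
    by blast+
qed

text \<open>For k <= 3 the tabulated forms arise from the pair in \<open>eta_product_theta\<close>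
  by unimodular substitutions, some of determinant -1, which leave the theta functions
  unchanged.\<close>

theorem eta_product_schoeneberg:
  assumes D: "prime D" "D mod 24 = 23" and pair: "schoeneberg_pair D = (Qs, Qr)" and z: "Im z > 0"
  shows "dedekind_eta z * dedekind_eta (of_nat D * z) = half_theta_diff Qs Qr z"
proof -
  define k where "k = (int D + 1) div 24"
  have k: "int D + 1 = 24 * k" unfolding k_def using D(2) by presburger
  have swap: "form_theta (QForm a b c) z = form_theta (QForm c b a) z" for a b c
    by (rule form_theta_cong_unimodular[of 0 0 1 1]) (simp_all add: qeval_def algebra_simps)
  have "half_theta_diff (QForm 6 1 k) (QForm 6 5 (k + 1)) z = half_theta_diff Qs Qr z"
    using schoeneberg_pair_cases[OF D k]
  proof cases
    case 1
    then show ?thesis using pair by simp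
  next
    case 2
    \<comment> \<open>The substitution is (x, y) to (x + y, x), of determinant -1; for k = 2 and k =
      3 it is (x + y, -x), of determinant 1.\<close>
    have "form_theta (QForm 6 5 2) z = form_theta (QForm 2 1 3) z"
      by (rule form_theta_cong_unimodular[of 1 0 1 1]) (simp_all add: qeval_def power2_eq_square algebra_simps)
    then show ?thesis using pair 2 swap[of 6 1 1] by (simp add: half_theta_diff_def)
  next
    case 3
    have "form_theta (QForm 6 5 3) z = form_theta (QForm 3 1 4) z"
      by (rule form_theta_cong_unimodular[of 1 0 1 "-1"]) (simp_all add: qeval_def power2_eq_square algebra_simps)
    then show ?thesis using pair 3 swap[of 6 1 2] by (simp add: half_theta_diff_def)
  next
    case 4
    have "form_theta (QForm 6 5 4) z = form_theta (QForm 4 3 5) z"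
      by (rule form_theta_cong_unimodular[of 1 0 1 "-1"]) (simp_all add: qeval_def power2_eq_square algebra_simps)
    then show ?thesis using pair 4 swap[of 6 1 3] by (simp add: half_theta_diff_def)
  qed
  then show ?thesis using eta_product_theta[OF k z] by simp
qed

text \<open>By the classification either both leading coefficients are 6, which fixes the last
  coefficients and forces k >= 6, or a = k < a'. In the second case 3a'^2 <= D rules out k >= 6 and
  gives a' = k + 1 for k <= 3; divisibility of b^2 + D by 4a then determines |b|, and likewise
  |b'|.\<close>

lemma schoeneberg_pair_unique_reduced:
  assumes D: "prime D" "D mod 24 = 23" and pair: "schoeneberg_pair D = (Qs0, Qr0)"
    and Qs: "reduced_form Qs" "discriminant Qs = - int D"
    and Qr: "reduced_form Qr" "discriminant Qr = - int D"
    and eq: "\<And>z. Im z > 0 \<Longrightarrow> dedekind_eta z * dedekind_eta (of_nat D * z) = half_theta_diff Qs Qr z"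
  shows "(Qs = Qs0 \<or> Qs = conjugate_form Qs0) \<and> (Qr = Qr0 \<or> Qr = conjugate_form Qr0)"
proof -
  define k where "k = (int D + 1) div 24"
  have k: "int D + 1 = 24 * k" unfolding k_def using D(2) by presburger
  have neg: "- int D < 0" using D(1) prime_gt_0_nat by simp
  have *: "qa Qs < qa Qr \<and> 24 * qa Qs = int D + 1 \<or> qa Qs = 6 \<and> qa Qr = 6 \<and> \<bar>qb Qs\<bar> = 1 \<and> \<bar>qb Qr\<bar> = 5"
    using eta_quotient_eq_half_theta_diffD[OF D(1) Qs Qr, of 1 1] eq by simp
  obtain a b c where s: "Qs = QForm a b c" by (cases Qs)
  obtain a' b' c' where r: "Qr = QForm a' b' c'" by (cases Qr)
  have ds: "\<bar>b\<bar> \<le> a" "a \<le> c" "4 * a * c = b\<^sup>2 + 24 * k - 1"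
    using Qs k by (auto simp: s reduced_form_def discriminant_def)
  have dr: "\<bar>b'\<bar> \<le> a'" "a' \<le> c'" "4 * a' * c' = b'\<^sup>2 + 24 * k - 1"
    using Qr k by (auto simp: r reduced_form_def discriminant_def)
  have "3 * a'\<^sup>2 \<le> int D" using reduced_disc_bound(1)[OF Qr(1)] Qr(2) neg by (simp add: r)
  then have bound: "3 * (a' * a') \<le> 24 * k - 1" using k by (simp add: power2_eq_square)
  from * show ?thesis
  proof
    assume "qa Qs = 6 \<and> qa Qr = 6 \<and> \<bar>qb Qs\<bar> = 1 \<and> \<bar>qb Qr\<bar> = 5"
    then have v: "a = 6" "a' = 6" "b = 1 \<or> b = - 1" "b' = 5 \<or> b' = - 5" by (auto simp: s r)
    then have "c = k" "c' = k + 1" using ds dr by auto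
    then have "k \<ge> 6" using ds v by simp
    from schoeneberg_pair_cases[OF D k] this
    have "Qs0 = QForm 6 1 k" "Qr0 = QForm 6 5 (k + 1)" by (cases; use pair in simp)+
    then show ?thesis using v \<open>c = k\<close> \<open>c' = k + 1\<close> by (auto simp: s r conjugate_form_def)
  next
    assume "qa Qs < qa Qr \<and> 24 * qa Qs = int D + 1"
    then have a: "a = k" "k < a'" using k by (auto simp: s r)
    have k0: "k \<ge> 1" using k by presburger
    \<comment> \<open>Used with m = k + 2: the inequalities 23 < 27, 47 < 48 and 71 < 75 leave only
      a' = k + 1.\<close>
    have upper: "a' < m" if "24 * k - 1 < 3 * (m * m)" "m > 0" for m
    proof (rule ccontr)
      assume "\<not> a' < m"
      then have "m * m \<le> a' * a'" using that by (intro mult_mono) auto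
      then show False using bound that by simp
    qed
    have sq: "b\<^sup>2 = \<bar>b\<bar> * \<bar>b\<bar>" "b'\<^sup>2 = \<bar>b'\<bar> * \<bar>b'\<bar>" by (simp_all add: power2_eq_square)
    from schoeneberg_pair_cases[OF D k] show ?thesis
    proof cases
      case 1
      \<comment> \<open>Since 3 (k + 1)^2 = 3 (k - 3)^2 + 24k - 24 and (k - 3)^2 >= 9, this exceeds
        24k - 1, so a' > k is impossible.\<close>
      have "(k + 1) * (k + 1) \<le> a' * a'" using a k0 by (intro mult_mono) auto
      then have "3 * ((k + 1) * (k + 1)) \<le> 24 * k - 1" using bound by linarith
      moreover have "3 * ((k + 1) * (k + 1)) = 3 * ((k - 3) * (k - 3)) + 24 * k - 24" by (simp add: algebra_simps)
      moreover have "3 * 3 \<le> (k - 3) * (k - 3)" using 1 by (intro mult_mono) auto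
      ultimately show ?thesis by linarith
    next
      case 2
      have "a' = 2" using a upper[of 3] 2 by simp
      moreover have "\<bar>b\<bar> = 0 \<or> \<bar>b\<bar> = 1" using ds a 2 by linarith
      moreover have "\<bar>b'\<bar> = 0 \<or> \<bar>b'\<bar> = 1 \<or> \<bar>b'\<bar> = 2" using dr \<open>a' = 2\<close> by linarith
      ultimately have "\<bar>b\<bar> = 1 \<and> c = 6 \<and> \<bar>b'\<bar> = 1 \<and> c' = 3"
        using ds(3) dr(3) a 2 unfolding sq by (elim disjE) (simp_all, presburger+)
      then show ?thesis using pair 2 a \<open>a' = 2\<close> by (auto simp: s r conjugate_form_def abs_if split: if_splits)
    next
      case 3
      have "a' = 3" using a upper[of 4] 3 by simp
      moreover have "\<bar>b\<bar> = 0 \<or> \<bar>b\<bar> = 1 \<or> \<bar>b\<bar> = 2" using ds a 3 by linarith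
      moreover have "\<bar>b'\<bar> = 0 \<or> \<bar>b'\<bar> = 1 \<or> \<bar>b'\<bar> = 2 \<or> \<bar>b'\<bar> = 3" using dr \<open>a' = 3\<close> by linarith
      ultimately have "\<bar>b\<bar> = 1 \<and> c = 6 \<and> \<bar>b'\<bar> = 1 \<and> c' = 4"
        using ds(3) dr(3) a 3 unfolding sq by (elim disjE) (simp_all, presburger+)
      then show ?thesis using pair 3 a \<open>a' = 3\<close> by (auto simp: s r conjugate_form_def abs_if split: if_splits)
    next
      case 4
      have "a' = 4" using a upper[of 5] 4 by simp
      moreover have "\<bar>b\<bar> = 0 \<or> \<bar>b\<bar> = 1 \<or> \<bar>b\<bar> = 2 \<or> \<bar>b\<bar> = 3" using ds a 4 by linarith
      moreover have "\<bar>b'\<bar> = 0 \<or> \<bar>b'\<bar> = 1 \<or> \<bar>b'\<bar> = 2 \<or> \<bar>b'\<bar> = 3 \<or> \<bar>b'\<bar> = 4" using dr \<open>a' = 4\<close> by linarith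
      ultimately have "\<bar>b\<bar> = 1 \<and> c = 6 \<and> \<bar>b'\<bar> = 3 \<and> c' = 5"
        using ds(3) dr(3) a 4 unfolding sq by (elim disjE) (simp_all, presburger+)
      then show ?thesis using pair 4 a \<open>a' = 4\<close> by (auto simp: s r conjugate_form_def abs_if split: if_splits)
    qed
  qed
qed

section \<open>From reduced forms to the characterization and to uniqueness for arbitrary
  forms\<close>

theorem theorem1p5:
  fixes D :: nat
  assumes "prime D"
  shows "(\<forall>E. is_eta_quotient D E \<longrightarrow>
            (is_half_theta_diff D E \<longleftrightarrow>
               D mod 24 = 23 \<and>
               (\<forall>z\<in>upper_half_plane. E z = dedekind_eta z * dedekind_eta (of_nat D * z))))
       \<and> (D mod 24 = 23 \<longrightarrow>
            (\<forall>Qs0 Qr0. schoeneberg_pair D = (Qs0, Qr0) \<longrightarrow>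
               Qs0 \<in> forms_of_disc (- int D) \<and> reduced_form Qs0 \<and>
               Qr0 \<in> forms_of_disc (- int D) \<and> reduced_form Qr0 \<and> Qs0 \<noteq> Qr0 \<and>
               (\<forall>z\<in>upper_half_plane.
                  dedekind_eta z * dedekind_eta (of_nat D * z) =
                  1 / 2 * ((\<Sum>\<^sub>\<infinity>(a, b)\<in>(UNIV :: (int \<times> int) set). nome z powi qeval Qs0 a b)
                         - (\<Sum>\<^sub>\<infinity>(a, b)\<in>(UNIV :: (int \<times> int) set). nome z powi qeval Qr0 a b))) \<and>
               (\<forall>Qs\<in>forms_of_disc (- int D). \<forall>Qr\<in>forms_of_disc (- int D).
                  (\<forall>z\<in>upper_half_plane.
                     dedekind_eta z * dedekind_eta (of_nat D * z) = half_theta_diff Qs Qr z) \<longrightarrow>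
                  (properly_equivalent Qs Qs0 \<or> properly_equivalent Qs (conjugate_form Qs0)) \<and>
                  (properly_equivalent Qr Qr0 \<or> properly_equivalent Qr (conjugate_form Qr0)))))"
  (is "?characterization \<and> (_ \<longrightarrow> ?schoeneberg)")
proof (rule conjI)
  show ?characterization
  proof (intro allI impI iffI)
    fix E assume quot: "is_eta_quotient D E" and diff: "is_half_theta_diff D E"
    obtain r where E: "\<And>z. Im z > 0 \<Longrightarrow> E z = (\<Prod>\<delta> | \<delta> dvd D. dedekind_eta (of_nat \<delta> * z) powi r \<delta>)"
      using quot unfolding is_eta_quotient_def upper_half_plane_def by blast
    \<comment> \<open>A prime level has exactly two divisors, so an eta quotient is given by two
      exponents.\<close>
    have "{\<delta>. \<delta> dvd D} = {1, D}" "D \<noteq> 1" using assms by (auto simp: prime_nat_iff)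
    then have E: "E z = dedekind_eta z powi r 1 * dedekind_eta (of_nat D * z) powi r D" if "Im z > 0" for z
      using E[OF that] by simp
    obtain Qs Qr where Q: "Qs \<in> forms_of_disc (- int D)" "reduced_form Qs" "Qr \<in> forms_of_disc (- int D)" "reduced_form Qr"
      "\<And>z. Im z > 0 \<Longrightarrow> E z = half_theta_diff Qs Qr z"
      using diff unfolding is_half_theta_diff_def upper_half_plane_def by blast
    have "r 1 = 1 \<and> r D = 1 \<and> D mod 24 = 23"
      using eta_quotient_eq_half_theta_diffD[of D Qs Qr "r 1" "r D"] assms Q E by (auto simp: forms_of_disc_def)
    then show "D mod 24 = 23 \<and> (\<forall>z\<in>upper_half_plane. E z = dedekind_eta z * dedekind_eta (of_nat D * z))"
      using E by (simp add: upper_half_plane_def)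
  next
    fix E assume E: "D mod 24 = 23 \<and> (\<forall>z\<in>upper_half_plane. E z = dedekind_eta z * dedekind_eta (of_nat D * z))"
    obtain Qs Qr where pair: "schoeneberg_pair D = (Qs, Qr)" by (cases "schoeneberg_pair D")
    show "is_half_theta_diff D E"
      unfolding is_half_theta_diff_def
      using schoeneberg_pair_forms[OF assms _ pair] eta_product_schoeneberg[OF assms _ pair] E
      by (intro exI[of _ Qs] exI[of _ Qr]) (simp add: upper_half_plane_def)
  qed
  show "D mod 24 = 23 \<longrightarrow> ?schoeneberg"
  proof (intro impI allI)
    fix Qs0 Qr0 assume D: "D mod 24 = 23" and pair: "schoeneberg_pair D = (Qs0, Qr0)"
    have series: "\<forall>z\<in>upper_half_plane. dedekind_eta z * dedekind_eta (of_nat D * z) =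
        1 / 2 * ((\<Sum>\<^sub>\<infinity>(a, b)\<in>(UNIV :: (int \<times> int) set). nome z powi qeval Qs0 a b)
               - (\<Sum>\<^sub>\<infinity>(a, b)\<in>(UNIV :: (int \<times> int) set). nome z powi qeval Qr0 a b))"
      using eta_product_schoeneberg[OF assms D pair]
      by (simp add: upper_half_plane_def half_theta_diff_def form_theta_def)
    have unique: "(properly_equivalent Qs Qs0 \<or> properly_equivalent Qs (conjugate_form Qs0)) \<and>
        (properly_equivalent Qr Qr0 \<or> properly_equivalent Qr (conjugate_form Qr0))"
      if Q: "Qs \<in> forms_of_disc (- int D)" "Qr \<in> forms_of_disc (- int D)"
        and eq: "\<forall>z\<in>upper_half_plane. dedekind_eta z * dedekind_eta (of_nat D * z) = half_theta_diff Qs Qr z"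
      for Qs Qr
    proof -
      have neg: "- int D < 0" using assms prime_gt_0_nat by simp
      \<comment> \<open>Here the forms are arbitrary; each is replaced by a properly equivalent
        reduced form, which has the same theta function, so that the result for reduced forms
        carries over.\<close>
      obtain Rs where Rs: "properly_equivalent Qs Rs" "reduced_form Rs" "discriminant Rs = - int D"
        using exists_reduced_form[of Qs] Q(1) positive_definite_qa_pos neg by (auto simp: forms_of_disc_def)
      obtain Rr where Rr: "properly_equivalent Qr Rr" "reduced_form Rr" "discriminant Rr = - int D"
        using exists_reduced_form[of Qr] Q(2) positive_definite_qa_pos neg by (auto simp: forms_of_disc_def)
      have "dedekind_eta z * dedekind_eta (of_nat D * z) = half_theta_diff Rs Rr z" if "Im z > 0" for z
        using eq that form_theta_properly_equivalent[OF Rs(1)] form_theta_properly_equivalent[OF Rr(1)]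
        by (simp add: half_theta_diff_def upper_half_plane_def)
      then show ?thesis
        using schoeneberg_pair_unique_reduced[OF assms D pair Rs(2,3) Rr(2,3)] Rs(1) Rr(1) by blast
    qed
    show "Qs0 \<in> forms_of_disc (- int D) \<and> reduced_form Qs0 \<and>
        Qr0 \<in> forms_of_disc (- int D) \<and> reduced_form Qr0 \<and> Qs0 \<noteq> Qr0 \<and>
        (\<forall>z\<in>upper_half_plane. dedekind_eta z * dedekind_eta (of_nat D * z) =
           1 / 2 * ((\<Sum>\<^sub>\<infinity>(a, b)\<in>(UNIV :: (int \<times> int) set). nome z powi qeval Qs0 a b)
                  - (\<Sum>\<^sub>\<infinity>(a, b)\<in>(UNIV :: (int \<times> int) set). nome z powi qeval Qr0 a b))) \<and>
        (\<forall>Qs\<in>forms_of_disc (- int D). \<forall>Qr\<in>forms_of_disc (- int D).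
           (\<forall>z\<in>upper_half_plane. dedekind_eta z * dedekind_eta (of_nat D * z) = half_theta_diff Qs Qr z) \<longrightarrow>
           (properly_equivalent Qs Qs0 \<or> properly_equivalent Qs (conjugate_form Qs0)) \<and>
           (properly_equivalent Qr Qr0 \<or> properly_equivalent Qr (conjugate_form Qr0)))"
      using schoeneberg_pair_forms[OF assms D pair] series unique by blast
  qed
qed

end
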